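(* Let $\mathfrak{P}$ be a compactness-like topological property and let $X$ and $Y$ be locally-$\mathfrak{P}$ spaces, neither of which has $\mathfrak{P}$. If $(\mathscr{E}_\mathfrak{P}(X),\leq)$ and $(\mathscr{E}_\mathfrak{P}(Y),\leq)$ are order-isomorphic, then $\beta X\setminus\lambda_\mathfrak{P}X$ and $\beta Y\setminus\lambda_\mathfrak{P}Y$ are homeomorphic.
   Context: All spaces are completely regular Hausdorff; $\beta X$ is the Stone–Čech compactification. An extension of $X$ is a space containing $X$ as a dense subspace; its remainder is $Y\setminus X$. Extensions are identified up to homeomorphisms fixing $X$ pointwise, and $Y\leq Y'$ means there is a continuous map $Y'\to Y$ fixing $X$ pointwise. For a topological property $\mathfrak{P}$, $\mathscr{E}_\mathfrak{P}(X)$ is the set of all extensions of $X$ with $\mathfrak{P}$ and compact remainder, ordered by $\leq$. $X$ is locally-$\mathfrak{P}$ if each point has an open neighborhood whose closure has $\mathfrak{P}$. $\mathrm{Coz}(X)$ is the set of cozero-sets $X\setminus f^{-1}(0)$, $f:X\to[0,1]$ continuous. Define $\lambda_\mathfrak{P}X=\bigcup\{\mathrm{int}_{\beta X}\mathrm{cl}_{\beta X}C: C\in\mathrm{Coz}(X),\ \mathrm{cl}_XC\text{ has }\mathfrak{P}\}$. A topological property $\mathfrak{P}$ is compactness-like if: it is hereditary to clopen subspaces; it is finitely additive (a space that is a finite disjoint union of closed subspaces each with $\mathfrak{P}$ has $\mathfrak{P}$); it is invariant and inverse invariant under perfect surjections (closed continuous surjections with compact fibers); and it satisfies Mrówka's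 condition (W): if a space $Z$ has a point $p$ with an open base $\mathscr{B}$ at $p$ such that $Z\setminus B$ has $\mathfrak{P}$ for every $B\in\mathscr{B}$, then $Z$ has $\mathfrak{P}$. *)

theory Defs
  imports "HOL-Analysis.Analysis"
begin

text \<open>Standing convention: all spaces are completely regular Hausdorff (Tychonoff).\<close>
definition tych :: "'a topology \<Rightarrow> bool" where
  "tych X \<longleftrightarrow> completely_regular_space X \<and> Hausdorff_space X"

text \<open>A topological property is represented by a predicate on spaces of a universe type 'u;
  a space of any other type has the property iff it is homeomorphic to a 'u-space having it.\<close>
definition hasP :: "('u topology \<Rightarrow> bool) \<Rightarrow> 'x topology \<Rightarrow> bool" where
  "hasP P S \<longleftrightarrow> (\<exists>U. P U \<and> S homeomorphic_space U)"

definition compactness_like :: "('u topology \<Rightarrow> bool) \<Rightarrow> bool" where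
  "compactness_like P \<longleftrightarrow>
    \<comment> \<open>hereditary to clopen subspaces\<close>
    (\<forall>Z A. tych Z \<and> P Z \<and> closedin Z A \<and> openin Z A \<longrightarrow> P (subtopology Z A)) \<and>
    \<comment> \<open>finitely additive\<close>
    (\<forall>Z F. tych Z \<and> finite F \<and> F \<noteq> {} \<and> pairwise disjnt F \<and> \<Union>F = topspace Z \<and>
        (\<forall>A\<in>F. closedin Z A \<and> P (subtopology Z A)) \<longrightarrow> P Z) \<and>
    \<comment> \<open>invariant and inverse invariant under perfect surjections\<close>
    (\<forall>Z W f. tych Z \<and> tych W \<and> perfect_map Z W f \<longrightarrow> (P Z \<longleftrightarrow> P W)) \<and>
    \<comment> \<open>Mrowka's condition (W)\<close>
    (\<forall>Z p B. tych Z \<and> p \<in> topspace Z \<and> (\<forall>V\<in>B. openin Z V \<and> p \<in> V) \<and>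
        (\<forall>U. openin Z U \<and> p \<in> U \<longrightarrow> (\<exists>V\<in>B. V \<subseteq> U)) \<and>
        (\<forall>V\<in>B. P (subtopology Z (topspace Z - V))) \<longrightarrow> P Z)"

definition locally_P :: "('u topology \<Rightarrow> bool) \<Rightarrow> 'a topology \<Rightarrow> bool" where
  "locally_P P X \<longleftrightarrow>
    (\<forall>x\<in>topspace X. \<exists>U. openin X U \<and> x \<in> U \<and> hasP P (subtopology X (X closure_of U)))"

definition is_ext :: "'a topology \<Rightarrow> 'e topology \<Rightarrow> ('a \<Rightarrow> 'e) \<Rightarrow> bool" where
  "is_ext X T e \<longleftrightarrow> tych T \<and> embedding_map X T e \<and> T closure_of (e ` topspace X) = topspace T"

definition EP_reps :: "('u topology \<Rightarrow> bool) \<Rightarrow> 'a topology \<Rightarrow> ('e topology \<times> ('a \<Rightarrow> 'e)) set" where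
  "EP_reps P X = {(T, e). is_ext X T e \<and> hasP P T \<and> compactin T (topspace T - e ` topspace X)}"

definition ext_le :: "'a topology \<Rightarrow> ('e topology \<times> ('a \<Rightarrow> 'e)) \<Rightarrow> ('e topology \<times> ('a \<Rightarrow> 'e)) \<Rightarrow> bool" where
  "ext_le X E E' \<longleftrightarrow> (\<exists>f. continuous_map (fst E') (fst E) f \<and>
      (\<forall>x\<in>topspace X. f (snd E' x) = snd E x))"

definition ext_eq :: "'a topology \<Rightarrow> ('e topology \<times> ('a \<Rightarrow> 'e)) \<Rightarrow> ('e topology \<times> ('a \<Rightarrow> 'e)) \<Rightarrow> bool" where
  "ext_eq X E E' \<longleftrightarrow> (\<exists>h. homeomorphic_map (fst E) (fst E') h \<and>
      (\<forall>x\<in>topspace X. h (snd E x) = snd E' x))"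

definition EP :: "('u topology \<Rightarrow> bool) \<Rightarrow> 'a topology \<Rightarrow> ('e topology \<times> ('a \<Rightarrow> 'e)) set set" where
  "EP P X = (\<lambda>E. {E' \<in> EP_reps P X. ext_eq X E E'}) ` EP_reps P X"

definition EP_le :: "'a topology \<Rightarrow> ('e topology \<times> ('a \<Rightarrow> 'e)) set \<Rightarrow> ('e topology \<times> ('a \<Rightarrow> 'e)) set \<Rightarrow> bool" where
  "EP_le X A B \<longleftrightarrow> (\<exists>E\<in>A. \<exists>E'\<in>B. ext_le X E E')"

definition order_isomorphic_EP ::
  "'a topology \<Rightarrow> ('e topology \<times> ('a \<Rightarrow> 'e)) set set \<Rightarrow> 'b topology \<Rightarrow> ('f topology \<times> ('b \<Rightarrow> 'f)) set set \<Rightarrow> bool" where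
  "order_isomorphic_EP X SX Y SY \<longleftrightarrow> (\<exists>\<phi>. bij_betw \<phi> SX SY \<and>
      (\<forall>A\<in>SX. \<forall>B\<in>SX. EP_le X A B \<longleftrightarrow> EP_le Y (\<phi> A) (\<phi> B)))"

definition stone_cech :: "'a topology \<Rightarrow> 'k topology \<Rightarrow> ('a \<Rightarrow> 'k) \<Rightarrow> bool" where
  "stone_cech X K e \<longleftrightarrow> compact_space K \<and> Hausdorff_space K \<and> embedding_map X K e \<and>
     K closure_of (e ` topspace X) = topspace K \<and>
     (\<forall>f. continuous_map X (top_of_set {0..1::real}) f \<longrightarrow>
        (\<exists>g. continuous_map K (top_of_set {0..1::real}) g \<and> (\<forall>x\<in>topspace X. g (e x) = f x)))"

definition coz :: "'a topology \<Rightarrow> 'a set set" where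
  "coz X = {{x \<in> topspace X. f x \<noteq> 0} | f. continuous_map X (top_of_set {0..1::real}) f}"

definition lambdaP :: "('u topology \<Rightarrow> bool) \<Rightarrow> 'a topology \<Rightarrow> 'k topology \<Rightarrow> ('a \<Rightarrow> 'k) \<Rightarrow> 'k set" where
  "lambdaP P X K e = \<Union>{K interior_of (K closure_of (e ` C)) | C.
      C \<in> coz X \<and> hasP P (subtopology X (X closure_of C))}"

end

theory Submission
  imports Defs "HOL-Library.Ramsey"
begin

text \<open>Let \<open>S = \<beta>X - \<lambda>X\<close>. An extension \<open>T\<close> of \<open>X\<close> with compact remainder is a perfect image of
  \<open>X \<union> C\<close> for a compact \<open>C \<subseteq> \<beta>X - X\<close>, and \<open>T\<close> has the property iff \<open>S \<subseteq> C\<close>. The fibres on \<open>C\<close> form a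
  closed partial equivalence relation on \<open>\<beta>X - X\<close> containing the diagonal of \<open>S\<close>; every such relation
  arises, and the order of extensions becomes reverse inclusion of relations.

  In this poset the atoms that identify two points of \<open>S\<close> are recognised by order alone, and so are
  the triples of such atoms forming a triangle. An order isomorphism therefore induces a bijection
  between the pairs of points of \<open>S\<close> and of its counterpart that preserves triangles, hence a bijection
  of points. A set \<open>A \<subseteq> S\<close> is closed iff it is the section of a member of the poset at one of its
  points, so this bijection is a homeomorphism.\<close>

section \<open>Quotients and perfect maps\<close>

definition quotient_topology :: "'a topology \<Rightarrow> ('a \<Rightarrow> 'b) \<Rightarrow> 'b topology" where
  "quotient_topology X q =
     topology (\<lambda>U. U \<subseteq> q ` topspace X \<and> openin X {x \<in> topspace X. q x \<in> U})"

lemma openin_quotient_topology: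
  "openin (quotient_topology X q) U \<longleftrightarrow> U \<subseteq> q ` topspace X \<and> openin X {x \<in> topspace X. q x \<in> U}"
proof -
  let ?L = "\<lambda>U. U \<subseteq> q ` topspace X \<and> openin X {x \<in> topspace X. q x \<in> U}"
  have "istopology ?L"
    unfolding istopology_def
  proof (intro conjI allI impI)
    fix S T assume "?L S" "?L T"
    moreover have "{x \<in> topspace X. q x \<in> S \<inter> T} = {x \<in> topspace X. q x \<in> S} \<inter> {x \<in> topspace X. q x \<in> T}"
      by auto
    ultimately show "S \<inter> T \<subseteq> q ` topspace X" "openin X {x \<in> topspace X. q x \<in> S \<inter> T}"
      by auto
  next
    fix \<F> assume \<F>: "\<forall>U\<in>\<F>. ?L U"
    have "{x \<in> topspace X. q x \<in> \<Union>\<F>} = (\<Union>U\<in>\<F>. {x \<in> topspace X. q x \<in> U})"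
      by auto
    with \<F> show "openin X {x \<in> topspace X. q x \<in> \<Union>\<F>}" "\<Union>\<F> \<subseteq> q ` topspace X"
      by auto
  qed
  then show ?thesis
    unfolding quotient_topology_def by simp
qed

lemma topspace_quotient_topology: "topspace (quotient_topology X q) = q ` topspace X"
proof
  have "{x \<in> topspace X. q x \<in> q ` topspace X} = topspace X" by auto
  then have "openin (quotient_topology X q) (q ` topspace X)"
    by (simp add: openin_quotient_topology)
  then show "q ` topspace X \<subseteq> topspace (quotient_topology X q)"
    by (rule openin_subset)
  show "topspace (quotient_topology X q) \<subseteq> q ` topspace X"
    using openin_topspace[of "quotient_topology X q"] unfolding openin_quotient_topology by blast
qed

lemma quotient_map_quotient_topology: "quotient_map X (quotient_topology X q) q"
  by (auto simp: quotient_map_def topspace_quotient_topology openin_quotient_topology)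

lemma lepoll_imp_homeomorphic_copy:
  assumes "topspace X \<lesssim> (UNIV :: 'b set)"
  obtains Y :: "'b topology" and f where "homeomorphic_map X Y f"
proof -
  obtain f :: "'a \<Rightarrow> 'b" where "inj_on f (topspace X)"
    using assms by (auto simp: lepoll_def)
  then have "homeomorphic_map X (quotient_topology X f) f"
    using quotient_map_quotient_topology by (simp add: homeomorphic_map_def)
  then show thesis by (rule that)
qed

lemma closed_kernel_imp_closed_map:
  assumes X: "compact_space X" and q: "quotient_map X Y q"
    and ker: "closedin (prod_topology X X) {(x, y) \<in> topspace X \<times> topspace X. q x = q y}"
  shows "closed_map X Y q"
  unfolding closed_map_def
proof (intro allI impI)
  let ?E = "{(x, y) \<in> topspace X \<times> topspace X. q x = q y}"
  fix A assume A: "closedin X A"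
  then have AX: "A \<subseteq> topspace X" by (rule closedin_subset)
  have "closedin (prod_topology X X) (?E \<inter> A \<times> topspace X)"
    using A ker by (intro closedin_Int) (auto simp: closedin_prod_Times_iff)
  then have "closedin X (snd ` (?E \<inter> A \<times> topspace X))"
    using closed_map_snd[OF X] unfolding closed_map_def by blast
  also have "snd ` (?E \<inter> A \<times> topspace X) = {y \<in> topspace X. q y \<in> q ` A}"
  proof (intro set_eqI iffI)
    fix y assume "y \<in> {y \<in> topspace X. q y \<in> q ` A}"
    then obtain a where "y \<in> topspace X" "a \<in> A" "q a = q y" by auto
    then have "(a, y) \<in> ?E \<inter> A \<times> topspace X" using AX by auto
    then show "y \<in> snd ` (?E \<inter> A \<times> topspace X)" by (rule image_eqI[rotated]) simp
  qed (auto intro: image_eqI[OF sym])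
  finally have "closedin X {y \<in> topspace X. q y \<in> q ` A}" .
  moreover have "q ` A \<subseteq> topspace Y"
    using AX quotient_imp_surjective_map[OF q] by blast
  ultimately show "closedin Y (q ` A)"
    using q by (simp add: quotient_map_closedin)
qed

lemma closed_equiv_quotient:
  fixes K :: "'k topology"
  assumes K: "compact_space K" "Hausdorff_space K" and card: "topspace K \<lesssim> (UNIV :: 'q set)"
    and E: "equiv (topspace K) E" "closedin (prod_topology K K) E"
  obtains Q :: "'q topology" and q
  where "compact_space Q" "Hausdorff_space Q" "perfect_map K Q q"
    "\<And>x y. x \<in> topspace K \<Longrightarrow> y \<in> topspace K \<Longrightarrow> q x = q y \<longleftrightarrow> (x, y) \<in> E"
proof -
  have "(\<lambda>x. E `` {x}) ` topspace K \<lesssim> (UNIV :: 'q set)"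
    using image_lepoll card by (rule lepoll_trans)
  then obtain g :: "'k set \<Rightarrow> 'q" where g: "inj_on g ((\<lambda>x. E `` {x}) ` topspace K)"
    by (auto simp: lepoll_def)
  define q where "q x = g (E `` {x})" for x
  define Q where "Q = quotient_topology K q"
  have q_eq: "q x = q y \<longleftrightarrow> (x, y) \<in> E" if "x \<in> topspace K" "y \<in> topspace K" for x y
    unfolding q_def using inj_on_eq_iff[OF g] eq_equiv_class_iff[OF E(1) that] that by simp
  have quot: "quotient_map K Q q"
    unfolding Q_def by (rule quotient_map_quotient_topology)
  have "{(x, y) \<in> topspace K \<times> topspace K. q x = q y} = E"
    using equiv_type[OF E(1)] by (auto simp: q_eq)
  then have closed: "closed_map K Q q"
    using closed_kernel_imp_closed_map[OF K(1) quot] E(2) by simp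
  have cont: "continuous_map K Q q" and surj: "q ` topspace K = topspace Q"
    by (rule quotient_imp_continuous_map[OF quot], rule quotient_imp_surjective_map[OF quot])
  have "compact_space Q"
    using image_compactin[OF _ cont, of "topspace K"] K(1) surj by (simp add: compact_space_def)
  moreover have "normal_space K"
    using K compact_Hausdorff_or_regular_imp_normal_space by blast
  then have "Hausdorff_space Q"
    using normal_Hausdorff_space_closed_continuous_map_image closed cont surj K(2) by blast
  moreover from this have "perfect_map K Q q"
    using continuous_imp_proper_map[OF K(1) Hausdorff_imp_kc_space cont] cont surj
    by (simp add: perfect_map_def)
  ultimately show thesis using q_eq by (rule that)
qed

lemma closedin_Id_on:
  assumes "Hausdorff_space X" "closedin X S"
  shows "closedin (prod_topology X X) (Id_on S)"
proof -
  have "closedin (prod_topology X X) ((\<lambda>x. (x, x)) ` topspace X \<inter> S \<times> S)"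
    using assms
    by (intro closedin_Int) (auto simp: closedin_prod_Times_iff Hausdorff_space_closedin_diagonal)
  moreover have "(\<lambda>x. (x, x)) ` topspace X \<inter> S \<times> S = Id_on S"
    using closedin_subset[OF assms(2)] by auto
  ultimately show ?thesis by simp
qed

lemma closed_per_quotient:
  fixes K :: "'k topology"
  assumes K: "compact_space K" "Hausdorff_space K" and card: "topspace K \<lesssim> (UNIV :: 'q set)"
    and r: "closedin (prod_topology K K) r" "sym r" "trans r"
  obtains Q :: "'q topology" and q
  where "compact_space Q" "Hausdorff_space Q" "perfect_map K Q q"
    "\<And>x y. x \<in> topspace K \<Longrightarrow> y \<in> topspace K \<Longrightarrow> q x = q y \<longleftrightarrow> x = y \<or> (x, y) \<in> r"
proof -
  have rK: "r \<subseteq> topspace K \<times> topspace K"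
    using closedin_subset[OF r(1)] by simp
  have "equiv (topspace K) (Id_on (topspace K) \<union> r)"
    using rK r(2,3) unfolding equiv_def refl_on_def sym_def trans_def by blast
  moreover have "closedin (prod_topology K K) (Id_on (topspace K) \<union> r)"
    using closedin_Id_on[OF K(2) closedin_topspace] r(1) by (rule closedin_Un)
  ultimately show thesis
  proof (rule closed_equiv_quotient[OF K card])
    fix Q :: "'q topology" and q
    assume "compact_space Q" "Hausdorff_space Q" "perfect_map K Q q"
      and "\<And>x y. x \<in> topspace K \<Longrightarrow> y \<in> topspace K \<Longrightarrow> q x = q y \<longleftrightarrow> (x, y) \<in> Id_on (topspace K) \<union> r"
    then show thesis by (intro that[of Q q]) auto
  qed
qed

lemma perfect_map_restriction:
  assumes q: "proper_map K Q q" "continuous_map K Q q"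
    and D: "{k \<in> topspace K. q k \<in> B} = D" and B: "B \<subseteq> q ` topspace K"
  shows "perfect_map (subtopology K D) (subtopology Q B) q"
proof -
  have "q ` D = B" "D \<subseteq> topspace K" using B unfolding D[symmetric] by auto
  moreover have "B \<subseteq> topspace Q"
    using B continuous_map_image_subset_topspace[OF q(2)] by blast
  ultimately show ?thesis
    unfolding perfect_map_def
    using proper_map_restriction[OF q(1) D] continuous_map_from_subtopology[OF q(2), of D]
    by (auto simp: continuous_map_in_subtopology Int_absorb1)
qed

lemma perfect_map_fst:
  assumes Y: "compact_space Y" and A: "closedin (prod_topology X Y) A"
  shows "perfect_map (subtopology (prod_topology X Y) A) (subtopology X (fst ` A)) fst"
    (is "perfect_map ?A ?X fst")
proof -
  have AXY: "A \<subseteq> topspace X \<times> topspace Y" using closedin_subset[OF A] by simp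
  then have top: "topspace ?A = A" "topspace ?X = fst ` A" by auto
  have "closed_map ?A X fst"
    using closed_map_fst[OF Y] A by (rule closed_map_from_subtopology)
  then have "closed_map ?A ?X fst"
    using top by (intro closed_map_into_subtopology) auto
  moreover have "compactin ?A {z \<in> topspace ?A. fst z = x}" if "x \<in> topspace ?X" for x
  proof -
    have x: "x \<in> topspace X" using that by simp
    have "compactin (prod_topology X Y) (A \<inter> {x} \<times> topspace Y)"
      using A Y x by (intro closed_Int_compactin) (auto simp: compactin_Times compact_space_def)
    moreover have "A \<inter> {x} \<times> topspace Y = {z \<in> topspace ?A. fst z = x}"
      using AXY unfolding top by auto
    ultimately show ?thesis by (auto simp: compactin_subtopology)
  qed
  moreover have "continuous_map ?A ?X fst"
    using top
    by (auto simp: continuous_map_in_subtopology continuous_map_from_subtopology continuous_map_fst)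
  ultimately show ?thesis
    unfolding perfect_map_def proper_map_def top by blast
qed

lemma homeomorphic_space_subtopology_image:
  assumes f: "homeomorphic_map X Y f" and S: "S \<subseteq> topspace X"
  shows "subtopology X S homeomorphic_space subtopology Y (f ` S)"
proof -
  have "f ` (topspace X \<inter> S) = topspace Y \<inter> f ` S"
    using S homeomorphic_imp_surjective_map[OF f] by blast
  then show ?thesis
    by (rule homeomorphic_map_imp_homeomorphic_space[OF homeomorphic_map_subtopologies[OF f]])
qed

lemma embedding_imp_continuous_map: "embedding_map X Y f \<Longrightarrow> continuous_map X Y f"
  unfolding embedding_map_def
  by (auto dest: homeomorphic_imp_continuous_map simp: continuous_map_in_subtopology)

lemma embedding_imp_inj_on: "embedding_map X Y f \<Longrightarrow> inj_on f (topspace X)"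
  unfolding embedding_map_def by (rule homeomorphic_imp_injective_map)

section \<open>Tychonoff spaces\<close>

lemma tych_homeomorphic:
  "X homeomorphic_space Y \<Longrightarrow> tych X \<longleftrightarrow> tych Y"
  unfolding tych_def using homeomorphic_Hausdorff_space homeomorphic_completely_regular_space by blast

lemma tych_homeomorphic_map_image: "homeomorphic_map X Y f \<Longrightarrow> tych X \<Longrightarrow> tych Y"
  using tych_homeomorphic homeomorphic_map_imp_homeomorphic_space by blast

lemma tych_subtopology: "tych X \<Longrightarrow> tych (subtopology X S)"
  unfolding tych_def by (simp add: Hausdorff_space_subtopology completely_regular_space_subtopology)

lemma tych_prod_topology: "tych X \<Longrightarrow> tych Y \<Longrightarrow> tych (prod_topology X Y)"
  unfolding tych_def by (simp add: Hausdorff_space_prod_topology completely_regular_space_prod_topology)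

lemma tych_discrete_topology: "tych (discrete_topology S)"
  unfolding tych_def by (simp add: completely_regular_space_discrete_topology)

lemma tych_compact_Hausdorff:
  assumes "compact_space X" "Hausdorff_space X"
  shows "tych X"
proof -
  have "normal_space X"
    using assms compact_Hausdorff_or_regular_imp_normal_space by blast
  then show ?thesis
    unfolding tych_def
    using assms(2) normal_imp_completely_regular_space_A Hausdorff_imp_t1_space by blast
qed

section \<open>Compactness-like properties of spaces of arbitrary type\<close>

lemma hasP_homeomorphic:
  assumes "S homeomorphic_space T"
  shows "hasP P S \<longleftrightarrow> hasP P T"
  unfolding hasP_def
  using homeomorphic_space_trans[OF assms]
    homeomorphic_space_trans[OF homeomorphic_space_sym[THEN iffD1, OF assms]]
  by blast

definition doubled :: "'z topology \<Rightarrow> ('z \<times> bool) topology" where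
  "doubled Z = prod_topology Z (discrete_topology UNIV)"

lemma topspace_doubled: "topspace (doubled Z) = topspace Z \<times> UNIV"
  by (simp add: doubled_def)

lemma tych_doubled: "tych Z \<Longrightarrow> tych (doubled Z)"
  unfolding doubled_def by (intro tych_prod_topology tych_discrete_topology)

lemma closedin_doubled_Times: "closedin (doubled Z) (A \<times> B) \<longleftrightarrow> A = {} \<or> B = {} \<or> closedin Z A"
  unfolding doubled_def by (auto simp: closedin_prod_Times_iff)

locale compactness_like_property =
  fixes P :: "'u topology \<Rightarrow> bool"
  assumes compactness_like: "compactness_like P"
begin

lemma P_clopen:
  "\<lbrakk>tych Z; P Z; closedin Z A; openin Z A\<rbrakk> \<Longrightarrow> P (subtopology Z A)"
  using compactness_like[unfolded compactness_like_def, THEN conjunct1] by blast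

lemma P_finite_additive:
  "\<lbrakk>tych Z; finite \<F>; \<F> \<noteq> {}; pairwise disjnt \<F>; \<Union>\<F> = topspace Z;
    \<And>A. A \<in> \<F> \<Longrightarrow> closedin Z A \<and> P (subtopology Z A)\<rbrakk> \<Longrightarrow> P Z"
  using compactness_like[unfolded compactness_like_def, THEN conjunct2, THEN conjunct1] by blast

lemma P_perfect:
  "\<lbrakk>tych Z; tych W; perfect_map Z W f\<rbrakk> \<Longrightarrow> P Z \<longleftrightarrow> P W"
  using compactness_like[unfolded compactness_like_def, THEN conjunct2, THEN conjunct2, THEN conjunct1]
  by blast

lemma P_condition_W:
  "\<lbrakk>tych Z; p \<in> topspace Z; \<And>V. openin Z V \<Longrightarrow> p \<in> V \<Longrightarrow> P (subtopology Z (topspace Z - V))\<rbrakk> \<Longrightarrow> P Z"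
  using compactness_like[unfolded compactness_like_def, THEN conjunct2, THEN conjunct2, THEN conjunct2,
      THEN spec, THEN spec, THEN spec, of Z p "{V. openin Z V \<and> p \<in> V}"]
  by blast

lemma hasP_iff_P:
  assumes "tych U"
  shows "hasP P U \<longleftrightarrow> P U"
proof
  assume "hasP P U"
  then obtain W f where W: "P W" "homeomorphic_map U W f"
    unfolding hasP_def homeomorphic_space by blast
  then have "tych W" using assms tych_homeomorphic_map_image by blast
  then show "P U"
    using P_perfect[OF assms _ homeomorphic_imp_perfect_map[OF W(2)]] W(1) by simp
qed (auto simp: hasP_def)

lemma hasP_subtopology_iff_P_image:
  assumes Z: "tych Z" and f: "homeomorphic_map Z U f" and A: "A \<subseteq> topspace Z"
  shows "hasP P (subtopology Z A) \<longleftrightarrow> P (subtopology U (f ` A))"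
proof -
  have "tych U" using f Z by (rule tych_homeomorphic_map_image)
  then show ?thesis
    using hasP_homeomorphic[OF homeomorphic_space_subtopology_image[OF f A], of P]
      hasP_iff_P[OF tych_subtopology, of U "f ` A"] by simp
qed

lemma hasP_iff_P_copy:
  assumes "tych Z" "homeomorphic_map Z U f"
  shows "hasP P Z \<longleftrightarrow> P U"
  using hasP_subtopology_iff_P_image[OF assms subset_refl] homeomorphic_imp_surjective_map[OF assms(2)]
  by simp

lemma hasP_clopen:
  assumes Z: "tych Z" "hasP P Z" and A: "closedin Z A" "openin Z A"
  shows "hasP P (subtopology Z A)"
proof -
  obtain U f where U: "P U" "homeomorphic_map Z U f"
    using Z(2) unfolding hasP_def homeomorphic_space by blast
  then have "tych U" using Z(1) tych_homeomorphic_map_image by blast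
  moreover have "closedin U (f ` A)" "openin U (f ` A)"
    using U(2) A homeomorphic_map_closedness_eq homeomorphic_map_openness_eq by blast+
  ultimately have "P (subtopology U (f ` A))"
    using U(1) P_clopen by blast
  then show ?thesis
    using hasP_subtopology_iff_P_image[OF Z(1) U(2) closedin_subset[OF A(1)]] by simp
qed

lemma hasP_perfect:
  assumes card: "topspace Z \<lesssim> (UNIV :: 'u set)"
    and Z: "tych Z" and W: "tych W" and f: "perfect_map Z W f"
  shows "hasP P Z \<longleftrightarrow> hasP P W"
proof -
  have "f ` topspace Z \<lesssim> (UNIV :: 'u set)"
    using image_lepoll card by (rule lepoll_trans)
  then have cardW: "topspace W \<lesssim> (UNIV :: 'u set)"
    using perfect_imp_surjective_map[OF f] by simp
  obtain Z' :: "'u topology" and g where g: "homeomorphic_map Z Z' g"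
    using lepoll_imp_homeomorphic_copy[OF card] .
  obtain W' :: "'u topology" and h where h: "homeomorphic_map W W' h"
    using lepoll_imp_homeomorphic_copy[OF cardW] .
  obtain k where k: "homeomorphic_map Z' Z k"
    using g homeomorphic_map_imp_homeomorphic_space homeomorphic_space homeomorphic_space_sym by blast
  have "perfect_map Z' W' (h \<circ> (f \<circ> k))"
    using homeomorphic_imp_perfect_map[OF k] f homeomorphic_imp_perfect_map[OF h]
    by (intro perfect_map_compose)
  moreover have "tych Z'" "tych W'"
    using tych_homeomorphic_map_image[OF g Z] tych_homeomorphic_map_image[OF h W] .
  ultimately have "P Z' \<longleftrightarrow> P W'" by (intro P_perfect)
  then show ?thesis
    using hasP_iff_P_copy[OF Z g] hasP_iff_P_copy[OF W h] by simp
qed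

lemma hasP_disjoint_Un:
  assumes card: "topspace Z \<lesssim> (UNIV :: 'u set)" and Z: "tych Z"
    and AB: "closedin Z A" "closedin Z B" "disjnt A B"
    and hasP: "hasP P (subtopology Z A)" "hasP P (subtopology Z B)"
  shows "hasP P (subtopology Z (A \<union> B))"
proof -
  obtain U :: "'u topology" and f where f: "homeomorphic_map Z U f"
    using lepoll_imp_homeomorphic_copy[OF card] .
  define V where "V = subtopology U (f ` (A \<union> B))"
  have "tych U" using f Z by (rule tych_homeomorphic_map_image)
  have clo: "closedin U (f ` C)" if "closedin Z C" for C
    using f that homeomorphic_map_closedness_eq by blast
  have piece: "closedin V (f ` C) \<and> P (subtopology V (f ` C))"
    if C: "closedin Z C" "C \<subseteq> A \<union> B" "hasP P (subtopology Z C)" for C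
  proof
    have "f ` C \<subseteq> f ` (A \<union> B)" using C(2) by (rule image_mono)
    then show "closedin V (f ` C)"
      unfolding V_def using clo[OF C(1)] by (simp add: closedin_subset_topspace)
    have "subtopology V (f ` C) = subtopology U (f ` C)"
      unfolding V_def subtopology_subtopology using \<open>f ` C \<subseteq> f ` (A \<union> B)\<close> by (simp add: Int_absorb1)
    then show "P (subtopology V (f ` C))"
      using C(3) hasP_subtopology_iff_P_image[OF Z f closedin_subset[OF C(1)]] by simp
  qed
  have sub: "A \<subseteq> topspace Z" "B \<subseteq> topspace Z"
    using AB closedin_subset by blast+
  have "P V"
  proof (rule P_finite_additive[of _ "{f ` A, f ` B}"])
    show "tych V" unfolding V_def by (rule tych_subtopology[OF \<open>tych U\<close>])
    have "f ` A \<inter> f ` B = f ` (A \<inter> B)"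
      using inj_on_image_Int[OF homeomorphic_imp_injective_map[OF f] sub] by simp
    then show "pairwise disjnt {f ` A, f ` B}"
      using AB(3) by (auto simp: pairwise_insert disjnt_def Int_commute)
    have "f ` (A \<union> B) \<subseteq> topspace U"
      using sub homeomorphic_imp_surjective_map[OF f] by blast
    then show "\<Union>{f ` A, f ` B} = topspace V"
      unfolding V_def by (simp add: image_Un Int_absorb1)
  qed (use piece AB hasP in auto)
  then show ?thesis
    using hasP_subtopology_iff_P_image[OF Z f, of "A \<union> B"] sub unfolding V_def by simp
qed

lemma hasP_condition_W:
  assumes card: "topspace Z \<lesssim> (UNIV :: 'u set)" and Z: "tych Z" and p: "p \<in> topspace Z"
    and V: "\<And>V. openin Z V \<Longrightarrow> p \<in> V \<Longrightarrow> hasP P (subtopology Z (topspace Z - V))"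
  shows "hasP P Z"
proof -
  obtain U :: "'u topology" and f where f: "homeomorphic_map Z U f"
    using lepoll_imp_homeomorphic_copy[OF card] .
  have top: "f ` topspace Z = topspace U" by (rule homeomorphic_imp_surjective_map[OF f])
  have "P U"
  proof (rule P_condition_W)
    show "tych U" using f Z by (rule tych_homeomorphic_map_image)
    show "f p \<in> topspace U" using p top by blast
    fix W assume W: "openin U W" "f p \<in> W"
    let ?V = "{x \<in> topspace Z. f x \<in> W}"
    have "openin Z ?V"
      using homeomorphic_imp_continuous_map[OF f] W(1) by (rule openin_continuous_map_preimage)
    then have "hasP P (subtopology Z (topspace Z - ?V))"
      using V p W(2) by blast
    moreover have "f ` (topspace Z - ?V) = topspace U - W" using top by auto
    ultimately show "P (subtopology U (topspace U - W))"
      using hasP_subtopology_iff_P_image[OF Z f, of "topspace Z - ?V"] by auto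
  qed
  then show ?thesis using hasP_iff_P_copy[OF Z f] by simp
qed

text \<open>Closed subspaces and unions that need not be disjoint are reached through closed subspaces of
  \<open>Z \<times> bool\<close> and their perfect projections to \<open>Z\<close>.\<close>

lemma hasP_doubled_iff:
  assumes card: "topspace Z \<times> (UNIV :: bool set) \<lesssim> (UNIV :: 'u set)" and Z: "tych Z"
    and W: "closedin (doubled Z) W"
  shows "hasP P (subtopology (doubled Z) W) \<longleftrightarrow> hasP P (subtopology Z (fst ` W))"
proof (rule hasP_perfect)
  have "topspace (subtopology (doubled Z) W) \<lesssim> topspace Z \<times> (UNIV :: bool set)"
    by (intro subset_imp_lepoll) (simp add: topspace_doubled)
  then show "topspace (subtopology (doubled Z) W) \<lesssim> (UNIV :: 'u set)"
    using card by (rule lepoll_trans)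
  show "perfect_map (subtopology (doubled Z) W) (subtopology Z (fst ` W)) fst"
    using W unfolding doubled_def
    by (intro perfect_map_fst) (simp_all add: compact_space_discrete_topology)
qed (intro tych_subtopology tych_doubled Z)+

lemma hasP_closed_Un:
  assumes card: "topspace Z \<times> (UNIV :: bool set) \<lesssim> (UNIV :: 'u set)" and Z: "tych Z"
    and AB: "closedin Z A" "closedin Z B"
    and hasP: "hasP P (subtopology Z A)" "hasP P (subtopology Z B)"
  shows "hasP P (subtopology Z (A \<union> B))"
proof -
  let ?W = "A \<times> {False} \<union> B \<times> {True}"
  have clo: "closedin (doubled Z) (A \<times> {False})" "closedin (doubled Z) (B \<times> {True})"
    using AB by (simp_all add: closedin_doubled_Times)
  have "hasP P (subtopology (doubled Z) ?W)"
  proof (rule hasP_disjoint_Un[OF _ tych_doubled[OF Z] clo])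
    show "topspace (doubled Z) \<lesssim> (UNIV :: 'u set)" using card by (simp add: topspace_doubled)
    show "hasP P (subtopology (doubled Z) (A \<times> {False}))" "hasP P (subtopology (doubled Z) (B \<times> {True}))"
      using hasP hasP_doubled_iff[OF card Z clo(1)] hasP_doubled_iff[OF card Z clo(2)] by simp_all
  qed (auto simp: disjnt_def)
  moreover have "fst ` ?W = A \<union> B" by (simp add: image_Un)
  ultimately show ?thesis
    using hasP_doubled_iff[OF card Z closedin_Un[OF clo]] by simp
qed

lemma hasP_closed:
  assumes card: "topspace Z \<times> (UNIV :: bool set) \<lesssim> (UNIV :: 'u set)" and Z: "tych Z"
    and A: "closedin Z A" and hasP: "hasP P Z"
  shows "hasP P (subtopology Z A)"
proof -
  let ?Z = "topspace Z \<times> {False}" and ?A = "A \<times> {True}"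
  let ?W = "subtopology (doubled Z) (?Z \<union> ?A)"
  have sub: "A \<subseteq> topspace Z" using A by (rule closedin_subset)
  have clo: "closedin (doubled Z) ?Z" "closedin (doubled Z) ?A"
    using A by (simp_all add: closedin_doubled_Times)
  have top: "topspace ?W = ?Z \<union> ?A" using sub by (auto simp: topspace_doubled)
  have "fst ` (?Z \<union> ?A) = topspace Z" using sub by (auto simp: image_Un)
  then have "hasP P ?W"
    using hasP hasP_doubled_iff[OF card Z closedin_Un[OF clo]] by simp
  moreover have "closedin ?W ?Z" "closedin ?W ?A"
    using clo by (auto intro: closedin_subset_topspace)
  moreover have "topspace ?W - ?Z = ?A" unfolding top by auto
  then have "openin ?W ?A" using \<open>closedin ?W ?Z\<close> by (metis openin_diff openin_topspace)
  ultimately have "hasP P (subtopology ?W ?A)"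
    by (intro hasP_clopen[OF tych_subtopology[OF tych_doubled[OF Z]]])
  moreover have "subtopology ?W ?A = subtopology (doubled Z) ?A"
    unfolding subtopology_subtopology by (simp add: Int_absorb1)
  ultimately show ?thesis
    using hasP_doubled_iff[OF card Z clo(2)] by simp
qed

lemma hasP_closedin_subtopology:
  assumes card: "topspace Z \<times> (UNIV :: bool set) \<lesssim> (UNIV :: 'u set)" and Z: "tych Z"
    and hasP: "hasP P (subtopology Z B)" and A: "closedin (subtopology Z B) A"
  shows "hasP P (subtopology Z A)"
proof -
  have "topspace (subtopology Z B) \<times> (UNIV :: bool set) \<lesssim> topspace Z \<times> (UNIV :: bool set)"
    by (intro subset_imp_lepoll) auto
  then have "hasP P (subtopology (subtopology Z B) A)"
    using lepoll_trans[OF _ card] by (intro hasP_closed tych_subtopology Z hasP A)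
  moreover have "A \<subseteq> B" using closedin_subset[OF A] by simp
  ultimately show ?thesis by (simp add: subtopology_subtopology Int_absorb1)
qed

lemma hasP_finite_UN_closed:
  assumes card: "topspace Z \<times> (UNIV :: bool set) \<lesssim> (UNIV :: 'u set)" and Z: "tych Z"
    and I: "finite I" "\<And>i. i \<in> I \<Longrightarrow> closedin Z (A i)" "\<And>i. i \<in> I \<Longrightarrow> hasP P (subtopology Z (A i))"
    and empty: "hasP P (subtopology Z {})"
  shows "hasP P (subtopology Z (\<Union>i\<in>I. A i))"
  using I
proof (induction I rule: finite_induct)
  case (insert i I)
  then have "closedin Z (\<Union>i\<in>I. A i)" by (intro closedin_Union) auto
  then show ?case using insert hasP_closed_Un[OF card Z] by simp
qed (use empty in simp)

end

section \<open>Bijections between pairs of points\<close>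

definition triangle :: "'a set \<Rightarrow> 'a set \<Rightarrow> 'a set \<Rightarrow> bool" where
  "triangle A B C \<longleftrightarrow> (\<exists>p q r. p \<noteq> q \<and> p \<noteq> r \<and> q \<noteq> r \<and> A = {p, q} \<and> B = {p, r} \<and> C = {q, r})"

lemma triangleE:
  assumes "triangle A B C"
  obtains p q r where "p \<noteq> q" "p \<noteq> r" "q \<noteq> r" "A = {p, q}" "B = {p, r}" "C = {q, r}"
  using assms unfolding triangle_def by metis

lemma triangle_Int:
  assumes "triangle A B C"
  shows "A \<inter> B \<noteq> {}" "A \<inter> B \<inter> C = {}"
  using assms by (auto elim!: triangleE)

locale triangle_preserving_bijection =
  fixes F :: "'a set \<Rightarrow> 'b set" and S :: "'a set" and T :: "'b set"
  assumes bij: "bij_betw F ([S]\<^bsup>2\<^esup>) ([T]\<^bsup>2\<^esup>)"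
    and preserves_triangle: "\<lbrakk>A \<in> [S]\<^bsup>2\<^esup>; B \<in> [S]\<^bsup>2\<^esup>; C \<in> [S]\<^bsup>2\<^esup>; triangle A B C\<rbrakk>
      \<Longrightarrow> triangle (F A) (F B) (F C)"
begin

lemma image_in_nsets: "x \<in> S \<Longrightarrow> y \<in> S \<Longrightarrow> x \<noteq> y \<Longrightarrow> F {x, y} \<in> [T]\<^bsup>2\<^esup>"
  using bij_betwE[OF bij] by simp

lemma ex_preimage_doubleton:
  assumes "u \<in> T" "v \<in> T" "u \<noteq> v"
  obtains x y where "x \<in> S" "y \<in> S" "x \<noteq> y" "F {x, y} = {u, v}"
proof -
  have "{u, v} \<in> F ` [S]\<^bsup>2\<^esup>" using assms bij by (simp add: bij_betw_def)
  then obtain A where "A \<in> [S]\<^bsup>2\<^esup>" "F A = {u, v}" by auto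
  then show thesis using that by (auto elim: nsets2_E)
qed

lemma triangle_doubletons:
  assumes "a \<in> S" "b \<in> S" "c \<in> S" "a \<noteq> b" "a \<noteq> c" "b \<noteq> c"
  shows "triangle (F {a, b}) (F {a, c}) (F {b, c})"
  using assms by (intro preserves_triangle) (auto simp: triangle_def)

text \<open>Three pairwise intersecting pairs form a triangle or a star. As triangles are preserved,
  the images of the pairs through \<open>a\<close> form a star, whose centre will be the image of \<open>a\<close>.\<close>

lemma ex_star_centre:
  assumes a: "a \<in> S" and bc: "b \<in> S" "c \<in> S" "b \<noteq> a" "c \<noteq> a" "b \<noteq> c"
  shows "\<exists>p. \<forall>w\<in>S - {a}. p \<in> F {a, w}"
proof -
  have "triangle (F {a, b}) (F {a, c}) (F {b, c})"
    using a bc by (intro triangle_doubletons) auto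
  then obtain p q r where pqr: "p \<noteq> q" "p \<noteq> r" "q \<noteq> r"
      "F {a, b} = {p, q}" "F {a, c} = {p, r}" "F {b, c} = {q, r}"
    by (rule triangleE)
  have "p \<in> F {a, w}" if w: "w \<in> S" "w \<noteq> a" for w
  proof (rule ccontr)
    assume p: "p \<notin> F {a, w}"
    then have wbc: "w \<noteq> b" "w \<noteq> c" using pqr by auto
    have "triangle (F {a, b}) (F {a, w}) (F {b, w})" "triangle (F {a, c}) (F {a, w}) (F {c, w})"
      using triangle_doubletons a bc w wbc by metis+
    then have "{p, q} \<inter> F {a, w} \<noteq> {}" "{p, r} \<inter> F {a, w} \<noteq> {}"
      using triangle_Int(1) pqr(4,5) by metis+
    then have "q \<in> F {a, w}" "r \<in> F {a, w}" using p by auto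
    moreover have "F {a, w} \<in> [T]\<^bsup>2\<^esup>" using image_in_nsets a w by blast
    ultimately have "F {a, w} = F {b, c}" using pqr by (auto elim!: nsets2_E)
    then have "{a, w} = {b, c}"
      using inj_onD[OF bij_betw_imp_inj_on[OF bij]] a bc w by simp
    then show False using bc by auto
  qed
  then show ?thesis by blast
qed

lemma ex_star_centres:
  assumes xyz: "x \<in> S" "y \<in> S" "z \<in> S" "x \<noteq> y" "x \<noteq> z" "y \<noteq> z"
  shows "\<exists>h. inj_on h S \<and> (\<forall>a\<in>S. \<forall>w\<in>S - {a}. h a \<in> F {a, w})"
proof -
  have "\<exists>p. \<forall>w\<in>S - {a}. p \<in> F {a, w}" if "a \<in> S" for a
    using ex_star_centre[OF that, of x y] ex_star_centre[OF that, of x z] ex_star_centre[OF that, of y z]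
      xyz by blast
  then obtain h where h: "\<forall>a\<in>S. \<forall>w\<in>S - {a}. h a \<in> F {a, w}" by metis
  have "inj_on h S"
  proof (rule inj_onI, rule ccontr)
    fix a b assume ab: "a \<in> S" "b \<in> S" "h a = h b" "a \<noteq> b"
    obtain c where c: "c \<in> S" "c \<noteq> a" "c \<noteq> b" using xyz by metis
    have "h a \<in> F {a, b}" "h a \<in> F {a, c}" "h a \<in> F {b, c}"
      using h ab c by auto
    moreover have "triangle (F {a, b}) (F {a, c}) (F {b, c})"
      using triangle_doubletons ab c by metis
    ultimately show False using triangle_Int(2) by blast
  qed
  then show ?thesis using h by blast
qed

lemma induced_point_bijection_of_three:
  assumes xyz: "x \<in> S" "y \<in> S" "z \<in> S" "x \<noteq> y" "x \<noteq> z" "y \<noteq> z"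
  obtains h where "bij_betw h S T" "\<And>a b. a \<in> S \<Longrightarrow> b \<in> S \<Longrightarrow> a \<noteq> b \<Longrightarrow> F {a, b} = {h a, h b}"
proof -
  obtain h where inj: "inj_on h S"
    and centre: "\<forall>a\<in>S. \<forall>w\<in>S - {a}. h a \<in> F {a, w}"
    using ex_star_centres[OF xyz] by blast
  have F_eq: "F {a, b} = {h a, h b}" if ab: "a \<in> S" "b \<in> S" "a \<noteq> b" for a b
  proof -
    have "h a \<in> F {a, b}" "h b \<in> F {b, a}" "h a \<noteq> h b"
      using centre ab inj_onD[OF inj] by blast+
    then have "h a \<in> F {a, b}" "h b \<in> F {a, b}" "h a \<noteq> h b"
      by (simp_all add: insert_commute)
    then show ?thesis using image_in_nsets[OF ab] by (auto elim!: nsets2_E)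
  qed
  have "h ` S = T"
  proof
    show "h ` S \<subseteq> T"
    proof clarify
      fix a assume a: "a \<in> S"
      then obtain b where b: "b \<in> S" "a \<noteq> b" using xyz by metis
      then have "{h a, h b} \<in> [T]\<^bsup>2\<^esup>" using image_in_nsets[OF a b] F_eq[OF a b] by simp
      then show "h a \<in> T" by simp
    qed
    show "T \<subseteq> h ` S"
    proof
      fix u assume u: "u \<in> T"
      have "{h x, h y} \<in> [T]\<^bsup>2\<^esup>" using image_in_nsets[OF xyz(1,2,4)] F_eq[OF xyz(1,2,4)] by simp
      then obtain v where "v \<in> T" "u \<noteq> v" by auto
      then obtain a b where ab: "a \<in> S" "b \<in> S" "a \<noteq> b" "F {a, b} = {u, v}"
        using ex_preimage_doubleton[OF u] by metis
      then have "u \<in> {h a, h b}" using F_eq by blast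
      then show "u \<in> h ` S" using ab by blast
    qed
  qed
  then have "bij_betw h S T" using inj by (simp add: bij_betw_def)
  then show thesis using F_eq by (rule that)
qed

lemma induced_point_bijection_of_two:
  assumes S: "S = {x, y}" and T: "T \<noteq> {}"
  obtains h where "bij_betw h S T" "\<And>a b. a \<in> S \<Longrightarrow> b \<in> S \<Longrightarrow> a \<noteq> b \<Longrightarrow> F {a, b} = {h a, h b}"
proof (cases "x = y")
  case True
  obtain u where u: "u \<in> T" using T by blast
  have "v = u" if "v \<in> T" for v
    by (rule ccontr, rule ex_preimage_doubleton[OF that u]) (use S True in auto)
  then have "T = {u}" using u by blast
  then show thesis
    using S True by (intro that[of "\<lambda>_. u"]) (auto simp: bij_betw_def)
next
  case False
  have "F {x, y} \<in> [T]\<^bsup>2\<^esup>" using image_in_nsets S False by simp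
  then obtain u v where uv: "F {x, y} = {u, v}" "u \<in> T" "v \<in> T" "u \<noteq> v" by (auto elim: nsets2_E)
  have "w \<in> {u, v}" if w: "w \<in> T" for w
  proof (rule ccontr)
    assume "w \<notin> {u, v}"
    then obtain a b where "a \<in> S" "b \<in> S" "a \<noteq> b" "F {a, b} = {w, u}"
      using ex_preimage_doubleton[OF w uv(2)] by auto
    moreover have "{a, b} = {x, y}" if "a \<in> S" "b \<in> S" "a \<noteq> b" for a b
      using S that by blast
    ultimately have "{w, u} = {u, v}" using uv(1) by metis
    then show False using \<open>w \<notin> {u, v}\<close> by auto
  qed
  then have "T = {u, v}" using uv by blast
  then have "bij_betw (\<lambda>z. if z = x then u else v) S T"
    using S False uv(4) by (auto simp: bij_betw_def inj_on_def)
  moreover have "F {a, b} = {if a = x then u else v, if b = x then u else v}"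
    if ab: "a \<in> S" "b \<in> S" "a \<noteq> b" for a b
  proof -
    consider "a = x" "b = y" | "a = y" "b = x" using S ab by blast
    then show ?thesis using False uv(1) by cases (simp_all add: insert_commute)
  qed
  ultimately show thesis by (rule that)
qed

lemma induced_point_bijection:
  assumes "S \<noteq> {}" "T \<noteq> {}"
  obtains h where "bij_betw h S T" "\<And>a b. a \<in> S \<Longrightarrow> b \<in> S \<Longrightarrow> a \<noteq> b \<Longrightarrow> F {a, b} = {h a, h b}"
proof -
  obtain x where x: "x \<in> S" using assms(1) by blast
  show thesis
  proof (cases "\<exists>y. S = {x, y}")
    case True
    then obtain y where "S = {x, y}" by blast
    then show thesis using assms(2) that by (rule induced_point_bijection_of_two)
  next
    case False
    then obtain y where y: "y \<in> S" "x \<noteq> y" using x by blast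
    then obtain z where "z \<in> S" "x \<noteq> z" "y \<noteq> z" using False x by blast
    then show thesis using induced_point_bijection_of_three[OF x y(1) _ y(2)] that by metis
  qed
qed

end

section \<open>Atoms of a poset\<close>

definition atom_in :: "'a :: order set \<Rightarrow> 'a \<Rightarrow> bool" where
  "atom_in R a \<longleftrightarrow> a \<in> R \<and> \<not> (\<forall>r\<in>R. a \<le> r) \<and> (\<forall>r\<in>R. r \<le> a \<longrightarrow> r = a \<or> (\<forall>r'\<in>R. r \<le> r'))"

definition branching_atom :: "'a :: order set \<Rightarrow> 'a \<Rightarrow> bool" where
  "branching_atom R a \<longleftrightarrow>
     atom_in R a \<and> (\<forall>r\<in>R. a \<le> r \<and> a \<noteq> r \<longrightarrow> (\<exists>b\<in>R. atom_in R b \<and> b \<le> r \<and> b \<noteq> a))"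

definition order_iso :: "('a :: order \<Rightarrow> 'b :: order) \<Rightarrow> 'a set \<Rightarrow> 'b set \<Rightarrow> bool" where
  "order_iso \<Phi> R R' \<longleftrightarrow> bij_betw \<Phi> R R' \<and> (\<forall>a\<in>R. \<forall>b\<in>R. \<Phi> a \<le> \<Phi> b \<longleftrightarrow> a \<le> b)"

lemma order_isoD:
  assumes "order_iso \<Phi> R R'"
  shows order_iso_image: "\<Phi> ` R = R'"
    and order_iso_inj: "inj_on \<Phi> R"
    and order_iso_le_iff: "a \<in> R \<Longrightarrow> b \<in> R \<Longrightarrow> \<Phi> a \<le> \<Phi> b \<longleftrightarrow> a \<le> b"
    and order_iso_eq_iff: "a \<in> R \<Longrightarrow> b \<in> R \<Longrightarrow> \<Phi> a = \<Phi> b \<longleftrightarrow> a = b"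
  using assms unfolding order_iso_def by (auto simp: bij_betw_def inj_on_eq_iff)

lemma atom_in_imp_mem: "atom_in R a \<Longrightarrow> a \<in> R"
  by (simp add: atom_in_def)

lemma atom_in_order_iso:
  assumes iso: "order_iso \<Phi> R R'" and a: "a \<in> R"
  shows "atom_in R' (\<Phi> a) \<longleftrightarrow> atom_in R a"
  unfolding atom_in_def order_iso_image[OF iso, symmetric]
  using a by (auto simp: order_iso_le_iff[OF iso] order_iso_eq_iff[OF iso])

lemma branching_atom_order_iso:
  assumes iso: "order_iso \<Phi> R R'" and a: "a \<in> R"
  shows "branching_atom R' (\<Phi> a) \<longleftrightarrow> branching_atom R a"
proof -
  have "atom_in (\<Phi> ` R) (\<Phi> r) \<longleftrightarrow> atom_in R r" if "r \<in> R" for r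
    using atom_in_order_iso[OF iso that] order_iso_image[OF iso] by simp
  then show ?thesis
    unfolding branching_atom_def order_iso_image[OF iso, symmetric]
    using a by (simp add: order_iso_le_iff[OF iso] order_iso_eq_iff[OF iso])
qed

section \<open>The poset of closed partial equivalence relations\<close>

definition closed_pers :: "'k topology \<Rightarrow> 'k set \<Rightarrow> 'k set \<Rightarrow> ('k \<times> 'k) set set" where
  "closed_pers K N S =
     {r. closedin (prod_topology K K) r \<and> r \<subseteq> N \<times> N \<and> sym r \<and> trans r \<and> Id_on S \<subseteq> r}"

definition collapse :: "'k set \<Rightarrow> 'k set \<Rightarrow> ('k \<times> 'k) set" where
  "collapse S A = Id_on S \<union> A \<times> A"

lemma collapse_iff: "(x, y) \<in> collapse S A \<longleftrightarrow> x = y \<and> x \<in> S \<or> x \<in> A \<and> y \<in> A"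
  by (auto simp: collapse_def)

lemma inj_on_collapse_nsets_2: "inj_on (collapse S) ([S]\<^bsup>2\<^esup>)"
proof (rule inj_onI)
  fix A B assume "A \<in> [S]\<^bsup>2\<^esup>" "B \<in> [S]\<^bsup>2\<^esup>" and eq: "collapse S A = collapse S B"
  then obtain s t u v where st: "s \<noteq> t" "A = {s, t}" and uv: "B = {u, v}"
    by (auto elim!: nsets2_E)
  then have "(s, t) \<in> collapse S B" unfolding eq[symmetric] by (simp add: collapse_iff)
  then have "s \<in> B" "t \<in> B" using st(1) by (simp_all add: collapse_iff)
  then show "A = B" using st uv by auto
qed

locale closed_per_poset =
  fixes K :: "'k topology" and N S :: "'k set"
  assumes Hausdorff: "Hausdorff_space K" and closedin_S: "closedin K S" and S_subset_N: "S \<subseteq> N"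
    and N_subset: "N \<subseteq> topspace K" and S_nonempty: "S \<noteq> {}"
begin

abbreviation "\<R> \<equiv> closed_pers K N S"

lemma per_sym: "r \<in> \<R> \<Longrightarrow> (x, y) \<in> r \<Longrightarrow> (y, x) \<in> r"
  unfolding closed_pers_def by (blast dest: symD)

lemma per_trans: "r \<in> \<R> \<Longrightarrow> (x, y) \<in> r \<Longrightarrow> (y, z) \<in> r \<Longrightarrow> (x, z) \<in> r"
  unfolding closed_pers_def by (blast dest: transD)

lemma per_field: "r \<in> \<R> \<Longrightarrow> (x, y) \<in> r \<Longrightarrow> x \<in> N \<and> y \<in> N"
  unfolding closed_pers_def by blast

lemma Id_on_subset_per: "r \<in> \<R> \<Longrightarrow> Id_on S \<subseteq> r"
  unfolding closed_pers_def by blast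

lemma Un_collapse_in_closed_pers:
  assumes "closedin K A" "A \<subseteq> N" "closedin K B" "B \<subseteq> N" "A \<inter> B = {}"
  shows "collapse S A \<union> B \<times> B \<in> \<R>"
  using assms closedin_Id_on[OF Hausdorff closedin_S] S_subset_N
  unfolding closed_pers_def collapse_def
  by (auto simp: sym_def trans_def closedin_prod_Times_iff intro!: closedin_Un)

lemma collapse_in_closed_pers: "closedin K A \<Longrightarrow> A \<subseteq> N \<Longrightarrow> collapse S A \<in> \<R>"
  using Un_collapse_in_closed_pers[of A "{}"] by simp

lemma Id_on_in_closed_pers: "Id_on S \<in> \<R>"
  using collapse_in_closed_pers[of "{}"] by (simp add: collapse_def)

lemma finite_imp_closedin: "finite A \<Longrightarrow> A \<subseteq> N \<Longrightarrow> closedin K A"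
  using Hausdorff N_subset closedin_Hausdorff_finite by blast

lemma collapse_doubleton_subset_iff:
  assumes r: "r \<in> \<R>"
  shows "collapse S {s, t} \<subseteq> r \<longleftrightarrow> (s, t) \<in> r"
proof
  show "collapse S {s, t} \<subseteq> r \<Longrightarrow> (s, t) \<in> r" by (auto simp: collapse_def)
  assume st: "(s, t) \<in> r"
  then have ts: "(t, s) \<in> r" by (rule per_sym[OF r])
  have "(s, s) \<in> r" "(t, t) \<in> r"
    using per_trans[OF r st ts] per_trans[OF r ts st] .
  then show "collapse S {s, t} \<subseteq> r"
    using st ts Id_on_subset_per[OF r] by (auto simp: collapse_def)
qed

lemma atom_in_closed_pers_iff:
  "atom_in \<R> a \<longleftrightarrow> a \<in> \<R> \<and> a \<noteq> Id_on S \<and> (\<forall>r\<in>\<R>. r \<subseteq> a \<longrightarrow> r = a \<or> r = Id_on S)"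
proof -
  have "(\<forall>r\<in>\<R>. b \<subseteq> r) \<longleftrightarrow> b = Id_on S" if "b \<in> \<R>" for b
    using that Id_on_in_closed_pers Id_on_subset_per by blast
  then show ?thesis unfolding atom_in_def by metis
qed

lemma atom_in_collapse_pair:
  assumes st: "s \<in> S" "t \<in> S" "s \<noteq> t"
  shows "atom_in \<R> (collapse S {s, t})"
  unfolding atom_in_closed_pers_iff
proof (intro conjI ballI impI)
  show "collapse S {s, t} \<in> \<R>"
    using st S_subset_N by (intro collapse_in_closed_pers finite_imp_closedin) auto
  show "collapse S {s, t} \<noteq> Id_on S" using st by (auto simp: collapse_def)
  fix r assume r: "r \<in> \<R>" "r \<subseteq> collapse S {s, t}"
  show "r = collapse S {s, t} \<or> r = Id_on S"
  proof (cases "(s, t) \<in> r")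
    case True
    then show ?thesis using collapse_doubleton_subset_iff[OF r(1)] r(2) by blast
  next
    case False
    then have "(t, s) \<notin> r" using per_sym[OF r(1)] by blast
    then show ?thesis using False r(2) Id_on_subset_per[OF r(1)] st by (auto simp: collapse_def)
  qed
qed

lemma atom_in_collapse_point:
  assumes p: "p \<in> N - S"
  shows "atom_in \<R> (collapse S {p})"
  unfolding atom_in_closed_pers_iff
proof (intro conjI ballI impI)
  show "collapse S {p} \<in> \<R>"
    using p by (intro collapse_in_closed_pers finite_imp_closedin) auto
  show "collapse S {p} \<noteq> Id_on S" using p by (auto simp: collapse_def)
  fix r assume r: "r \<in> \<R>" "r \<subseteq> collapse S {p}"
  then show "r = collapse S {p} \<or> r = Id_on S"
    using Id_on_subset_per[OF r(1)] by (auto simp: collapse_def)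
qed

lemma collapse_subset_per_cases:
  assumes r: "r \<in> \<R>" and xy: "(x, y) \<in> r" "(x, y) \<notin> Id_on S"
  obtains (point) p where "p \<in> N - S" "collapse S {p} \<subseteq> r" "p \<in> {x, y}"
    | (pair) "x \<in> S" "y \<in> S" "x \<noteq> y" "collapse S {x, y} \<subseteq> r"
proof (cases "x \<in> S \<and> y \<in> S")
  case True
  then show thesis using pair xy collapse_doubleton_subset_iff[OF r] by blast
next
  case False
  have "(x, x) \<in> r" "(y, y) \<in> r" "x \<in> N" "y \<in> N"
    using xy per_sym[OF r] per_trans[OF r] per_field[OF r] by blast+
  moreover have "collapse S {p} \<subseteq> r" if "(p, p) \<in> r" for p
    using collapse_doubleton_subset_iff[OF r, of p p] that by simp
  ultimately show thesis using False point[of x] point[of y] by blast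
qed

lemma atom_in_closed_pers_cases:
  assumes a: "atom_in \<R> a"
  obtains (pair) s t where "s \<in> S" "t \<in> S" "s \<noteq> t" "a = collapse S {s, t}"
    | (point) p where "p \<in> N - S" "a = collapse S {p}"
proof -
  have aR: "a \<in> \<R>" "a \<noteq> Id_on S"
    using a unfolding atom_in_closed_pers_iff by blast+
  have minimal: "b = a" if "atom_in \<R> b" "b \<subseteq> a" for b
    using a that unfolding atom_in_closed_pers_iff by metis
  have "\<not> a \<subseteq> Id_on S" using aR Id_on_subset_per by blast
  then obtain x y where xy: "(x, y) \<in> a" "(x, y) \<notin> Id_on S" by auto
  from aR(1) xy show thesis
  proof (cases rule: collapse_subset_per_cases)
    case (point p)
    then show thesis using that(2) minimal atom_in_collapse_point by metis
  next
    case pair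
    then show thesis using that(1) minimal atom_in_collapse_pair by metis
  qed
qed

text \<open>An atom that adds a point \<open>p\<close> outside \<open>S\<close> to the domain is the only atom below the relation
  gluing \<open>p\<close> to a point of \<open>S\<close>; so branching singles out the atoms that glue two points of \<open>S\<close>.\<close>

lemma not_branching_collapse_point:
  assumes p: "p \<in> N - S"
  shows "\<not> branching_atom \<R> (collapse S {p})"
proof -
  obtain s where s: "s \<in> S" using S_nonempty by blast
  let ?r = "collapse S {p, s}"
  have "?r \<in> \<R>"
    using s p S_subset_N by (intro collapse_in_closed_pers finite_imp_closedin) auto
  moreover have "collapse S {p} \<subseteq> ?r" "(p, s) \<in> ?r" "(p, s) \<notin> collapse S {p}"
    using p s by (auto simp: collapse_def)
  moreover have "b = collapse S {p}" if b: "atom_in \<R> b" "b \<subseteq> ?r" for b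
    using b(1)
  proof (cases rule: atom_in_closed_pers_cases)
    case (pair u v)
    then have "(u, v) \<in> ?r" using b(2) by (auto simp: collapse_def)
    then show ?thesis using pair p s by (auto simp: collapse_iff)
  next
    case (point q)
    then have "(q, q) \<in> ?r" using b(2) by (auto simp: collapse_def)
    then show ?thesis using point s by (auto simp: collapse_iff)
  qed
  ultimately show ?thesis unfolding branching_atom_def by blast
qed

lemma branching_collapse_pair:
  assumes st: "s \<in> S" "t \<in> S" "s \<noteq> t"
  shows "branching_atom \<R> (collapse S {s, t})"
  unfolding branching_atom_def
proof (intro conjI ballI impI)
  let ?a = "collapse S {s, t}"
  show "atom_in \<R> ?a" using atom_in_collapse_pair[OF st] .
  fix r assume r: "r \<in> \<R>" and "?a \<subseteq> r \<and> ?a \<noteq> r"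
  then obtain x y where xy: "(x, y) \<in> r" "(x, y) \<notin> ?a" by auto
  then have "(x, y) \<notin> Id_on S" by (auto simp: collapse_def)
  with r xy(1) have "\<exists>b. atom_in \<R> b \<and> b \<subseteq> r \<and> b \<noteq> ?a"
  proof (cases rule: collapse_subset_per_cases)
    case (point p)
    moreover have "(p, p) \<in> collapse S {p}" "(p, p) \<notin> ?a"
      using point st by (auto simp: collapse_iff)
    ultimately show ?thesis using atom_in_collapse_point by metis
  next
    case pair
    moreover have "(x, y) \<in> collapse S {x, y}" by (simp add: collapse_iff)
    ultimately show ?thesis using atom_in_collapse_pair xy(2) by metis
  qed
  then show "\<exists>b\<in>\<R>. atom_in \<R> b \<and> b \<subseteq> r \<and> b \<noteq> ?a"
    using atom_in_imp_mem by blast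
qed

lemma branching_atom_iff: "branching_atom \<R> a \<longleftrightarrow> a \<in> collapse S ` [S]\<^bsup>2\<^esup>"
proof
  assume a: "branching_atom \<R> a"
  then have "atom_in \<R> a" by (simp add: branching_atom_def)
  then show "a \<in> collapse S ` [S]\<^bsup>2\<^esup>"
  proof (cases rule: atom_in_closed_pers_cases)
    case (point p)
    then show ?thesis using a not_branching_collapse_point by blast
  qed simp
qed (auto elim!: nsets2_E intro: branching_collapse_pair)

lemma collapse_nsets_2_in_closed_pers: "A \<in> [S]\<^bsup>2\<^esup> \<Longrightarrow> collapse S A \<in> \<R>"
  using branching_atom_iff[of "collapse S A"] atom_in_imp_mem unfolding branching_atom_def by blast

lemma triangle_imp_collapse_subset:
  assumes t: "triangle A B C" and r: "r \<in> \<R>" "collapse S A \<subseteq> r" "collapse S B \<subseteq> r"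
  shows "collapse S C \<subseteq> r"
proof -
  obtain p q s where pqs: "A = {p, q}" "B = {p, s}" "C = {q, s}" using t by (rule triangleE)
  note subset_iff = collapse_doubleton_subset_iff[OF r(1)]
  have "(p, q) \<in> r" "(p, s) \<in> r" using r(2,3) unfolding pqs subset_iff .
  then have "(q, s) \<in> r" by (rule per_trans[OF r(1) per_sym[OF r(1)]])
  then show ?thesis unfolding pqs subset_iff .
qed

lemma collapse_subset_imp_triangle:
  assumes ABC: "A \<in> [S]\<^bsup>2\<^esup>" "B \<in> [S]\<^bsup>2\<^esup>" "C \<in> [S]\<^bsup>2\<^esup>" and ne: "A \<noteq> B" "A \<noteq> C" "B \<noteq> C"
    and below: "\<And>r. r \<in> \<R> \<Longrightarrow> collapse S A \<subseteq> r \<Longrightarrow> collapse S B \<subseteq> r \<Longrightarrow> collapse S C \<subseteq> r"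
  shows "triangle A B C"
proof -
  obtain x y where C: "C = {x, y}" "x \<noteq> y" using ABC(3) by (rule nsets2_E)
  have sub: "A \<subseteq> N" "B \<subseteq> N" "finite A" "finite B"
    using ABC S_subset_N by (auto simp: nsets_def)
  show ?thesis
  proof (cases "A \<inter> B = {}")
    case True
    let ?r = "collapse S A \<union> B \<times> B"
    have "?r \<in> \<R>"
      using sub True by (intro Un_collapse_in_closed_pers finite_imp_closedin)
    then have "collapse S C \<subseteq> ?r" by (rule below) (auto simp: collapse_def)
    then have "(x, y) \<in> ?r" using C by (auto simp: collapse_def)
    then have "C \<subseteq> A \<or> C \<subseteq> B" using C by (auto simp: collapse_def)
    then have "C = A \<or> C = B" using ABC by (auto elim!: nsets2_E)
    then show ?thesis using ne by blast
  next
    case False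
    then obtain p where p: "p \<in> A" "p \<in> B" by blast
    obtain q s where qs: "A = {p, q}" "p \<noteq> q" "B = {p, s}" "p \<noteq> s"
      using p ABC(1,2) by (auto elim!: nsets2_E)
    let ?r = "collapse S (A \<union> B)"
    have "?r \<in> \<R>"
      using sub by (intro collapse_in_closed_pers finite_imp_closedin) auto
    then have "collapse S C \<subseteq> ?r" by (rule below) (auto simp: collapse_def)
    then have "(x, y) \<in> ?r" using C by (auto simp: collapse_def)
    then have "x \<in> {p, q, s}" "y \<in> {p, q, s}" using C qs by (auto simp: collapse_def)
    then have "C = {q, s}" using C qs ne by auto
    moreover have "q \<noteq> s" using qs ne by auto
    ultimately show ?thesis using qs unfolding triangle_def by blast
  qed
qed

lemma closedin_iff_ex_section:
  assumes a: "a \<in> A" and A: "A \<subseteq> S"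
  shows "closedin K A \<longleftrightarrow> (\<exists>r\<in>\<R>. \<forall>x\<in>S. (a, x) \<in> r \<longleftrightarrow> x \<in> A)"
proof
  assume "closedin K A"
  then have "collapse S A \<in> \<R>" using A S_subset_N by (intro collapse_in_closed_pers) auto
  moreover have "(a, x) \<in> collapse S A \<longleftrightarrow> x \<in> A" for x
    using a by (auto simp: collapse_iff)
  ultimately show "\<exists>r\<in>\<R>. \<forall>x\<in>S. (a, x) \<in> r \<longleftrightarrow> x \<in> A" by blast
next
  assume "\<exists>r\<in>\<R>. \<forall>x\<in>S. (a, x) \<in> r \<longleftrightarrow> x \<in> A"
  then obtain r where r: "r \<in> \<R>" "\<And>x. x \<in> S \<Longrightarrow> (a, x) \<in> r \<longleftrightarrow> x \<in> A" by blast
  have "continuous_map K (prod_topology K K) (\<lambda>x. (a, x))"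
    using a A S_subset_N N_subset by (auto simp: continuous_map_pairwise o_def)
  then have "closedin K {x \<in> topspace K. (a, x) \<in> r}"
    using r(1) by (auto intro: closedin_continuous_map_preimage simp: closed_pers_def)
  then have "closedin K ({x \<in> topspace K. (a, x) \<in> r} \<inter> S)"
    using closedin_S by (rule closedin_Int)
  moreover have "{x \<in> topspace K. (a, x) \<in> r} \<inter> S = A"
    using r(2) A S_subset_N N_subset by blast
  ultimately show "closedin K A" by simp
qed

end

locale closed_per_iso =
  X: closed_per_poset K N S + Y: closed_per_poset K' N' T
  for K :: "'k topology" and N S and K' :: "'l topology" and N' T +
  fixes \<Phi> :: "('k \<times> 'k) set \<Rightarrow> ('l \<times> 'l) set"
  assumes iso: "order_iso \<Phi> X.\<R> Y.\<R>"
begin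

lemma bij_betw_collapsed_pairs: "bij_betw \<Phi> (collapse S ` [S]\<^bsup>2\<^esup>) (collapse T ` [T]\<^bsup>2\<^esup>)"
  unfolding bij_betw_def
proof
  have sub: "collapse S ` [S]\<^bsup>2\<^esup> \<subseteq> X.\<R>" using X.collapse_nsets_2_in_closed_pers by blast
  then show "inj_on \<Phi> (collapse S ` [S]\<^bsup>2\<^esup>)"
    using order_iso_inj[OF iso] by (rule inj_on_subset[rotated])
  show "\<Phi> ` collapse S ` [S]\<^bsup>2\<^esup> = collapse T ` [T]\<^bsup>2\<^esup>"
  proof
    show "\<Phi> ` collapse S ` [S]\<^bsup>2\<^esup> \<subseteq> collapse T ` [T]\<^bsup>2\<^esup>"
      using branching_atom_order_iso[OF iso] X.branching_atom_iff Y.branching_atom_iff sub by blast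
    show "collapse T ` [T]\<^bsup>2\<^esup> \<subseteq> \<Phi> ` collapse S ` [S]\<^bsup>2\<^esup>"
    proof
      fix b assume b: "b \<in> collapse T ` [T]\<^bsup>2\<^esup>"
      then have "b \<in> Y.\<R>" using Y.collapse_nsets_2_in_closed_pers by blast
      then obtain a where a: "a \<in> X.\<R>" "b = \<Phi> a" by (auto simp flip: order_iso_image[OF iso])
      then have "branching_atom X.\<R> a"
        using b Y.branching_atom_iff branching_atom_order_iso[OF iso a(1)] by simp
      then show "b \<in> \<Phi> ` collapse S ` [S]\<^bsup>2\<^esup>"
        using X.branching_atom_iff a(2) by blast
    qed
  qed
qed

definition pair_map :: "'k set \<Rightarrow> 'l set" where
  "pair_map = inv_into ([T]\<^bsup>2\<^esup>) (collapse T) \<circ> (\<Phi> \<circ> collapse S)"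

lemma bij_betw_pair_map: "bij_betw pair_map ([S]\<^bsup>2\<^esup>) ([T]\<^bsup>2\<^esup>)"
  unfolding pair_map_def
  by (rule bij_betw_trans[OF bij_betw_trans bij_betw_inv_into, OF _ bij_betw_collapsed_pairs])
    (intro inj_on_imp_bij_betw inj_on_collapse_nsets_2)+

lemma collapse_pair_map:
  assumes "A \<in> [S]\<^bsup>2\<^esup>"
  shows "collapse T (pair_map A) = \<Phi> (collapse S A)"
proof -
  have "\<Phi> (collapse S A) \<in> collapse T ` [T]\<^bsup>2\<^esup>"
    using assms bij_betwE[OF bij_betw_collapsed_pairs] by blast
  then show ?thesis by (simp add: pair_map_def f_inv_into_f)
qed

lemma image_in_closed_pers: "r \<in> X.\<R> \<Longrightarrow> \<Phi> r \<in> Y.\<R>"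
  using order_iso_image[OF iso] by blast

lemma collapse_pair_map_subset_iff:
  assumes "A \<in> [S]\<^bsup>2\<^esup>" "r \<in> X.\<R>"
  shows "collapse T (pair_map A) \<subseteq> \<Phi> r \<longleftrightarrow> collapse S A \<subseteq> r"
  unfolding collapse_pair_map[OF assms(1)]
  using order_iso_le_iff[OF iso X.collapse_nsets_2_in_closed_pers[OF assms(1)] assms(2)] .

sublocale pairs: triangle_preserving_bijection pair_map S T
proof
  show "bij_betw pair_map ([S]\<^bsup>2\<^esup>) ([T]\<^bsup>2\<^esup>)" by (rule bij_betw_pair_map)
  fix A B C assume ABC: "A \<in> [S]\<^bsup>2\<^esup>" "B \<in> [S]\<^bsup>2\<^esup>" "C \<in> [S]\<^bsup>2\<^esup>" and t: "triangle A B C"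
  have ne: "A \<noteq> B" "A \<noteq> C" "B \<noteq> C" using t by (auto elim!: triangleE simp: doubleton_eq_iff)
  show "triangle (pair_map A) (pair_map B) (pair_map C)"
  proof (rule Y.collapse_subset_imp_triangle)
    show "pair_map A \<in> [T]\<^bsup>2\<^esup>" "pair_map B \<in> [T]\<^bsup>2\<^esup>" "pair_map C \<in> [T]\<^bsup>2\<^esup>"
      using ABC bij_betwE[OF bij_betw_pair_map] by blast+
    show "pair_map A \<noteq> pair_map B" "pair_map A \<noteq> pair_map C" "pair_map B \<noteq> pair_map C"
      using ne ABC inj_on_eq_iff[OF bij_betw_imp_inj_on[OF bij_betw_pair_map]] by blast+
    fix r' assume r': "r' \<in> Y.\<R>" "collapse T (pair_map A) \<subseteq> r'" "collapse T (pair_map B) \<subseteq> r'"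
    then have "r' \<in> \<Phi> ` X.\<R>" using order_iso_image[OF iso] by simp
    then obtain r where "r \<in> X.\<R>" "r' = \<Phi> r" by blast
    then show "collapse T (pair_map C) \<subseteq> r'"
      using r'(2,3) X.triangle_imp_collapse_subset[OF t] ABC by (simp add: collapse_pair_map_subset_iff)
  qed
qed

lemma ex_point_bijection:
  obtains h where "bij_betw h S T"
    "\<And>r x y. r \<in> X.\<R> \<Longrightarrow> x \<in> S \<Longrightarrow> y \<in> S \<Longrightarrow> (h x, h y) \<in> \<Phi> r \<longleftrightarrow> (x, y) \<in> r"
proof -
  obtain h where h: "bij_betw h S T"
      "\<And>x y. x \<in> S \<Longrightarrow> y \<in> S \<Longrightarrow> x \<noteq> y \<Longrightarrow> pair_map {x, y} = {h x, h y}"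
    using pairs.induced_point_bijection[OF X.S_nonempty Y.S_nonempty] by blast
  have "(h x, h y) \<in> \<Phi> r \<longleftrightarrow> (x, y) \<in> r" if r: "r \<in> X.\<R>" and xy: "x \<in> S" "y \<in> S" for r x y
  proof (cases "x = y")
    case True
    have "h x \<in> T" using bij_betwE[OF h(1)] xy(1) by blast
    then show ?thesis
      using True xy(1) X.Id_on_subset_per[OF r] Y.Id_on_subset_per[OF image_in_closed_pers[OF r]] by blast
  next
    case False
    then have pair: "{x, y} \<in> [S]\<^bsup>2\<^esup>" using xy by simp
    have "(h x, h y) \<in> \<Phi> r \<longleftrightarrow> collapse T (pair_map {x, y}) \<subseteq> \<Phi> r"
      using Y.collapse_doubleton_subset_iff[OF image_in_closed_pers[OF r]] h(2)[OF xy False] by simp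
    also have "\<dots> \<longleftrightarrow> collapse S {x, y} \<subseteq> r" by (rule collapse_pair_map_subset_iff[OF pair r])
    also have "\<dots> \<longleftrightarrow> (x, y) \<in> r" by (rule X.collapse_doubleton_subset_iff[OF r])
    finally show ?thesis .
  qed
  then show thesis using h(1) that by blast
qed

lemma closedin_image_iff:
  assumes h: "bij_betw h S T"
    and rel: "\<And>r x y. r \<in> X.\<R> \<Longrightarrow> x \<in> S \<Longrightarrow> y \<in> S \<Longrightarrow> (h x, h y) \<in> \<Phi> r \<longleftrightarrow> (x, y) \<in> r"
    and A: "A \<subseteq> S"
  shows "closedin K' (h ` A) \<longleftrightarrow> closedin K A"
proof (cases "A = {}")
  case False
  then obtain a where a: "a \<in> A" by blast
  have image: "h ` S = T" and inj: "inj_on h S" using h by (auto simp: bij_betw_def)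
  have mem: "h x \<in> h ` A \<longleftrightarrow> x \<in> A" if "x \<in> S" for x
    using inj A that by (simp add: inj_on_image_mem_iff)
  have "closedin K A \<longleftrightarrow> (\<exists>r\<in>X.\<R>. \<forall>x\<in>S. (a, x) \<in> r \<longleftrightarrow> x \<in> A)"
    by (rule X.closedin_iff_ex_section[OF a A])
  also have "\<dots> \<longleftrightarrow> (\<exists>r\<in>X.\<R>. \<forall>x\<in>S. (h a, h x) \<in> \<Phi> r \<longleftrightarrow> h x \<in> h ` A)"
    using rel mem a A by (intro bex_cong refl ball_cong) auto
  also have "\<dots> \<longleftrightarrow> (\<exists>r\<in>X.\<R>. \<forall>v\<in>T. (h a, v) \<in> \<Phi> r \<longleftrightarrow> v \<in> h ` A)"
    unfolding image[symmetric] by simp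
  also have "\<dots> \<longleftrightarrow> (\<exists>r\<in>Y.\<R>. \<forall>v\<in>T. (h a, v) \<in> r \<longleftrightarrow> v \<in> h ` A)"
    unfolding order_iso_image[OF iso, symmetric] by simp
  also have "\<dots> \<longleftrightarrow> closedin K' (h ` A)"
    using a A image by (intro Y.closedin_iff_ex_section[symmetric]) auto
  finally show ?thesis by simp
qed simp

theorem homeomorphic_subspaces: "subtopology K S homeomorphic_space subtopology K' T"
proof -
  obtain h where h: "bij_betw h S T"
    and rel: "\<And>r x y. r \<in> X.\<R> \<Longrightarrow> x \<in> S \<Longrightarrow> y \<in> S \<Longrightarrow> (h x, h y) \<in> \<Phi> r \<longleftrightarrow> (x, y) \<in> r"
    using ex_point_bijection by blast
  have image: "h ` S = T" and inj: "inj_on h S" using h by (auto simp: bij_betw_def)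
  have top: "topspace (subtopology K S) = S" "topspace (subtopology K' T) = T"
    using closedin_subset[OF X.closedin_S] closedin_subset[OF Y.closedin_S] by auto
  have "quotient_map (subtopology K S) (subtopology K' T) h"
    unfolding quotient_map_closedin top
  proof (intro conjI allI impI image)
    fix V assume V: "V \<subseteq> T"
    then have "h ` {x \<in> S. h x \<in> V} = V" using image by blast
    then have "closedin K' V \<longleftrightarrow> closedin K {x \<in> S. h x \<in> V}"
      using closedin_image_iff[OF h rel, of "{x \<in> S. h x \<in> V}"] by auto
    then show "closedin (subtopology K S) {x \<in> S. h x \<in> V} \<longleftrightarrow> closedin (subtopology K' T) V"
      using V X.closedin_S Y.closedin_S by (auto simp: closedin_closed_subtopology)
  qed
  then have "homeomorphic_map (subtopology K S) (subtopology K' T) h"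
    unfolding homeomorphic_map_def top using inj by blast
  then show ?thesis by (rule homeomorphic_map_imp_homeomorphic_space)
qed

end

section \<open>Compactifications of a locally-\<open>P\<close> space\<close>

locale compactification =
  fixes X :: "'a topology" and K :: "'k topology" and e :: "'a \<Rightarrow> 'k"
  assumes compact_K: "compact_space K" and Hausdorff_K: "Hausdorff_space K"
    and embedding_e: "embedding_map X K e"
    and dense_image: "K closure_of (e ` topspace X) = topspace K"
begin

abbreviation "eX \<equiv> e ` topspace X"

lemma tych_K: "tych K"
  using compact_K Hausdorff_K by (rule tych_compact_Hausdorff)

lemma homeomorphic_e: "homeomorphic_map X (subtopology K eX) e"
  using embedding_e by (simp add: embedding_map_def)

lemma inj_on_e: "inj_on e (topspace X)"
  using embedding_e by (rule embedding_imp_inj_on)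

lemma continuous_e: "continuous_map X K e"
  using embedding_e by (rule embedding_imp_continuous_map)

lemma eX_subset: "eX \<subseteq> topspace K"
  using continuous_map_image_subset_topspace[OF continuous_e] by blast

lemma tych_X: "tych X"
  using tych_subtopology[OF tych_K]
    tych_homeomorphic[OF embedding_map_imp_homeomorphic_space[OF embedding_e]]
  by blast

lemma subtopology_homeomorphic_image:
  assumes "A \<subseteq> topspace X"
  shows "subtopology X A homeomorphic_space subtopology K (e ` A)"
proof -
  have "subtopology (subtopology K eX) (e ` A) = subtopology K (e ` A)"
    using assms by (simp add: subtopology_subtopology Int_absorb1 image_mono)
  then show ?thesis using homeomorphic_space_subtopology_image[OF homeomorphic_e assms] by simp
qed

lemma image_closure_of:
  assumes "A \<subseteq> topspace X"
  shows "e ` (X closure_of A) = eX \<inter> K closure_of (e ` A)"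
proof -
  have "e ` (X closure_of A) = subtopology K eX closure_of (e ` A)"
    using homeomorphic_map_closure_of[OF homeomorphic_e assms] by simp
  also have "\<dots> = eX \<inter> K closure_of (e ` A)"
    using assms by (simp add: closure_of_subtopology Int_absorb1 image_mono)
  finally show ?thesis .
qed

lemma openin_subset_closure_of:
  assumes "openin K U"
  shows "U \<subseteq> K closure_of (e ` {x \<in> topspace X. e x \<in> U})"
proof -
  have "e ` {x \<in> topspace X. e x \<in> U} = U \<inter> eX" by auto
  moreover have "U \<inter> K closure_of eX \<subseteq> K closure_of (U \<inter> eX)"
    using assms by (rule openin_Int_closure_of_subset)
  ultimately show ?thesis using dense_image openin_subset[OF assms] by auto
qed

lemma dense_in_subspace:
  assumes "eX \<subseteq> D" "D \<subseteq> topspace K"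
  shows "subtopology K D closure_of eX = D"
  using assms dense_image by (auto simp: closure_of_subtopology Int_absorb1 Int_absorb2)

text \<open>A point of \<open>K\<close> is determined by the subsets of \<open>X\<close> to which it adheres.\<close>

lemma topspace_lepoll_Pow_Pow: "topspace K \<lesssim> Pow (Pow (topspace X))"
proof -
  define adherent where "adherent k = {A \<in> Pow (topspace X). k \<in> K closure_of (e ` A)}" for k
  have "inj_on adherent (topspace K)"
  proof (rule inj_onI, rule ccontr)
    fix k l assume kl: "k \<in> topspace K" "l \<in> topspace K" "adherent k = adherent l" "k \<noteq> l"
    then obtain U V where UV: "openin K U" "openin K V" "k \<in> U" "l \<in> V" "disjnt U V"
      using Hausdorff_K unfolding Hausdorff_space_def by metis
    let ?A = "{x \<in> topspace X. e x \<in> U}"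
    have "?A \<in> adherent k"
      using openin_subset_closure_of[OF UV(1)] UV(3) by (auto simp: adherent_def)
    moreover have "?A \<notin> adherent l"
      using UV(2,4,5) unfolding adherent_def in_closure_of disjnt_def by blast
    ultimately show False using kl by simp
  qed
  moreover have "adherent ` topspace K \<subseteq> Pow (Pow (topspace X))" by (auto simp: adherent_def)
  ultimately show ?thesis unfolding lepoll_def by blast
qed

lemma topspace_lepoll_UNIV: "topspace K \<lesssim> (UNIV :: 'a set set set)"
  using topspace_lepoll_Pow_Pow subset_imp_lepoll by (rule lepoll_trans) simp

end

locale locally_P_compactification =
  compactness_like_property P + compactification X K e
  for P :: "'u topology \<Rightarrow> bool" and X :: "'a topology" and K :: "'k topology" and e +
  assumes locally_P: "locally_P P X" and not_hasP: "\<not> hasP P X" and nonempty: "topspace X \<noteq> {}"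
    and card: "(UNIV :: ('a set set \<times> bool) set) \<lesssim> (UNIV :: 'u set)"
begin

abbreviation "\<Lambda> \<equiv> lambdaP P X K e"
abbreviation "S \<equiv> topspace K - \<Lambda>"

lemma card_K: "topspace K \<times> (UNIV :: bool set) \<lesssim> (UNIV :: 'u set)"
proof -
  have "topspace K \<times> (UNIV :: bool set) \<lesssim> (UNIV :: 'a set set set) \<times> (UNIV :: bool set)"
    by (intro times_lepoll_mono topspace_lepoll_UNIV lepoll_refl)
  then show ?thesis using card by (simp add: lepoll_trans)
qed

lemma card_X: "topspace X \<times> (UNIV :: bool set) \<lesssim> (UNIV :: 'u set)"
proof -
  have "topspace X \<lesssim> topspace K"
    using inj_on_e eX_subset unfolding lepoll_def by blast
  then show ?thesis
    using lepoll_trans[OF times_lepoll_mono[OF _ lepoll_refl] card_K] by blast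
qed

lemma topspace_K_lepoll: "topspace K \<lesssim> (UNIV :: 'u set)"
  using lepoll_times1[of "UNIV :: bool set"] card_K by (blast intro: lepoll_trans)

lemma hasP_image_iff:
  "A \<subseteq> topspace X \<Longrightarrow> hasP P (subtopology K (e ` A)) \<longleftrightarrow> hasP P (subtopology X A)"
  using hasP_homeomorphic[OF subtopology_homeomorphic_image] by blast

lemma hasP_closed_subset:
  assumes "hasP P (subtopology X B)" "closedin X A" "A \<subseteq> B"
  shows "hasP P (subtopology X A)"
  using hasP_closedin_subtopology[OF card_X tych_X assms(1)] assms(2,3)
  by (simp add: closedin_subset_topspace)

text \<open>The interiors of closures of cozero-sets can be replaced by arbitrary neighbourhoods,
  as \<open>K\<close> is completely regular.\<close>

lemma mem_lambdaP_imp_ex_neighbourhood: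
  assumes "k \<in> \<Lambda>"
  shows "\<exists>U. openin K U \<and> k \<in> U \<and> hasP P (subtopology X (X closure_of {x \<in> topspace X. e x \<in> U}))"
proof -
  obtain C where C: "C \<in> coz X" "hasP P (subtopology X (X closure_of C))"
      "k \<in> K interior_of (K closure_of (e ` C))"
    using assms unfolding lambdaP_def by blast
  let ?U = "K interior_of (K closure_of (e ` C))"
  have CX: "C \<subseteq> topspace X" using C(1) unfolding coz_def by blast
  have "x \<in> X closure_of C" if x: "x \<in> topspace X" "e x \<in> ?U" for x
  proof -
    have "e x \<in> e ` (X closure_of C)"
      using x image_closure_of[OF CX] subsetD[OF interior_of_subset x(2)] by blast
    then show ?thesis
      using inj_on_image_mem_iff[OF inj_on_e x(1) closure_of_subset_topspace] by blast
  qed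
  then have "X closure_of {x \<in> topspace X. e x \<in> ?U} \<subseteq> X closure_of C"
    by (intro closure_of_minimal) auto
  then have "hasP P (subtopology X (X closure_of {x \<in> topspace X. e x \<in> ?U}))"
    by (intro hasP_closed_subset[OF C(2)]) auto
  then show ?thesis
    using C(3) by (intro exI[of _ ?U]) simp
qed

lemma mem_lambdaP_of_neighbourhood:
  assumes U: "openin K U" "k \<in> U" "hasP P (subtopology X (X closure_of {x \<in> topspace X. e x \<in> U}))"
  shows "k \<in> \<Lambda>"
proof -
  have k: "k \<in> topspace K" using openin_subset[OF U(1)] U(2) by blast
  then obtain g where g: "continuous_map K (top_of_set {0..1::real}) g" "g k = 0"
      "g ` (topspace K - U) \<subseteq> {1}"
    using tych_K U(1,2) unfolding tych_def completely_regular_space_def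
    by (metis DiffD2 DiffI closedin_diff closedin_topspace)
  define f where "f l = 1 - g l" for l
  have f: "continuous_map K (top_of_set {0..1}) f"
    using g(1) unfolding f_def by (auto simp: continuous_map_in_subtopology intro!: continuous_map_diff)
  let ?C = "{x \<in> topspace X. f (e x) \<noteq> 0}" and ?V = "{l \<in> topspace K. f l \<in> - {0}}"
  have "continuous_map X (top_of_set {0..1}) (f \<circ> e)"
    using continuous_e f by (rule continuous_map_compose)
  then have "?C \<in> coz X" unfolding coz_def by (auto simp: o_def)
  moreover have "?C \<subseteq> {x \<in> topspace X. e x \<in> U}"
    using g(3) eX_subset by (auto simp: f_def)
  then have "hasP P (subtopology X (X closure_of ?C))"
    by (intro hasP_closed_subset[OF U(3)] closure_of_mono) auto
  moreover have "continuous_map K euclideanreal f"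
    using f by (simp add: continuous_map_in_subtopology)
  then have V: "openin K ?V" by (rule openin_continuous_map_preimage) auto
  have "{x \<in> topspace X. e x \<in> ?V} = ?C" using eX_subset by auto
  then have "?V \<subseteq> K interior_of (K closure_of (e ` ?C))"
    using openin_subset_closure_of[OF V] V by (simp add: interior_of_maximal)
  then have "k \<in> K interior_of (K closure_of (e ` ?C))"
    using k g(2) by (auto simp: f_def)
  ultimately show ?thesis unfolding lambdaP_def by blast
qed

lemma eX_subset_lambdaP: "eX \<subseteq> \<Lambda>"
proof clarify
  fix x assume x: "x \<in> topspace X"
  then obtain U where U: "openin X U" "x \<in> U" "hasP P (subtopology X (X closure_of U))"
    using locally_P unfolding locally_P_def by blast
  then have "openin (subtopology K eX) (e ` U)"
    using homeomorphic_map_openness_eq[OF homeomorphic_e] by simp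
  then obtain V where V: "openin K V" "e ` U = V \<inter> eX"
    unfolding openin_subtopology by blast
  then have "{x \<in> topspace X. e x \<in> V} = U"
    using inj_on_image_mem_iff[OF inj_on_e _ openin_subset[OF U(1)]] openin_subset[OF U(1)] by blast
  moreover have "e x \<in> V" using U(2) V(2) by blast
  ultimately show "e x \<in> \<Lambda>"
    using U(3) by (intro mem_lambdaP_of_neighbourhood[OF V(1)]) simp_all
qed

lemma openin_lambdaP: "openin K \<Lambda>"
  unfolding lambdaP_def by (intro openin_Union) auto

lemma closedin_S: "closedin K S"
  using openin_lambdaP by blast

lemma hasP_empty: "hasP P (subtopology X {})"
proof -
  obtain x where "x \<in> topspace X" using nonempty by blast
  then obtain U where "hasP P (subtopology X (X closure_of U))"
    using locally_P unfolding locally_P_def by blast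
  then show ?thesis by (rule hasP_closed_subset) auto
qed

lemma hasP_outside_neighbourhood:
  assumes V: "openin K V" "S \<subseteq> V"
  shows "hasP P (subtopology X {x \<in> topspace X. e x \<notin> V})"
proof -
  let ?pre = "\<lambda>U. {x \<in> topspace X. e x \<in> U}"
  let ?\<U> = "{U. openin K U \<and> hasP P (subtopology X (X closure_of ?pre U))}"
  have "compactin K (topspace K - V)"
    using V(1) compact_K by (intro closedin_compact_space) auto
  moreover have "topspace K - V \<subseteq> \<Union>?\<U>"
    using V(2) mem_lambdaP_imp_ex_neighbourhood by blast
  ultimately obtain \<F> where \<F>: "finite \<F>" "\<F> \<subseteq> ?\<U>" "topspace K - V \<subseteq> \<Union>\<F>"
    using compactinD[of K "topspace K - V" ?\<U>] by blast
  have "hasP P (subtopology X (\<Union>U\<in>\<F>. X closure_of ?pre U))"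
    using \<F>(1,2) hasP_empty by (intro hasP_finite_UN_closed[OF card_X tych_X]) auto
  moreover have "closedin X (?pre (topspace K - V))"
    by (rule closedin_continuous_map_preimage[OF continuous_e]) (use V(1) in blast)
  moreover have "?pre (topspace K - V) = {x \<in> topspace X. e x \<notin> V}"
    using eX_subset by auto
  moreover have "{x \<in> topspace X. e x \<notin> V} \<subseteq> (\<Union>U\<in>\<F>. X closure_of ?pre U)"
  proof
    fix x assume x: "x \<in> {x \<in> topspace X. e x \<notin> V}"
    then obtain U where U: "U \<in> \<F>" "x \<in> ?pre U" using \<F>(3) eX_subset by blast
    then have "x \<in> X closure_of ?pre U"
      using closure_of_subset[of "?pre U" X] by blast
    then show "x \<in> (\<Union>U\<in>\<F>. X closure_of ?pre U)" using U(1) by blast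
  qed
  ultimately show ?thesis by (simp add: hasP_closed_subset)
qed

lemma S_nonempty: "S \<noteq> {}"
proof
  assume "S = {}"
  then have "hasP P (subtopology X {x \<in> topspace X. e x \<notin> {}})"
    by (intro hasP_outside_neighbourhood) auto
  then show False using not_hasP by simp
qed

lemma hasP_imp_S_subset:
  assumes D: "eX \<subseteq> D" "D \<subseteq> topspace K" "closedin K (D - eX)" and hasP: "hasP P (subtopology K D)"
  shows "S \<subseteq> D"
proof
  fix k assume k: "k \<in> S"
  show "k \<in> D"
  proof (rule ccontr)
    assume "k \<notin> D"
    have "regular_space K"
      using compact_K Hausdorff_K by (rule compact_Hausdorff_imp_regular_space)
    then obtain U V where UV: "openin K U" "openin K V" "k \<in> U" "D - eX \<subseteq> V" "disjnt U V"
      using k \<open>k \<notin> D\<close> D(3) unfolding regular_space_def by (metis Diff_iff)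
    let ?A = "{x \<in> topspace X. e x \<in> U}"
    have "K closure_of (e ` ?A) \<subseteq> topspace K - V"
      using UV(1,2,5) openin_subset[OF UV(1)] by (intro closure_of_minimal) (auto simp: disjnt_def)
    then have "(D - eX) \<inter> K closure_of (e ` ?A) = {}" using UV(4) by blast
    moreover have "e ` (X closure_of ?A) = eX \<inter> K closure_of (e ` ?A)"
      by (rule image_closure_of) blast
    ultimately have "e ` (X closure_of ?A) = D \<inter> K closure_of (e ` ?A)"
      using D(1) by blast
    then have "closedin (subtopology K D) (e ` (X closure_of ?A))"
      by (simp add: closedin_subtopology_Int_closed)
    then have "hasP P (subtopology X (X closure_of ?A))"
      using hasP_closedin_subtopology[OF card_K tych_K hasP]
        hasP_image_iff[OF closure_of_subset_topspace] by blast
    then have "k \<in> \<Lambda>" using UV(1,3) by (intro mem_lambdaP_of_neighbourhood)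
    then show False using k by blast
  qed
qed

lemma hasP_perfect_image_iff:
  assumes "tych T" "perfect_map (subtopology K B) T f"
  shows "hasP P (subtopology K B) \<longleftrightarrow> hasP P T"
proof (rule hasP_perfect)
  show "topspace (subtopology K B) \<lesssim> (UNIV :: 'u set)"
    by (rule lepoll_trans[OF subset_imp_lepoll topspace_K_lepoll]) simp
qed (use assms tych_subtopology[OF tych_K] in blast)+

lemma hasP_saturated_iff:
  assumes q: "tych Q" "perfect_map K Q q" and B: "{k \<in> topspace K. q k \<in> q ` B} = B"
  shows "hasP P (subtopology K B) \<longleftrightarrow> hasP P (subtopology Q (q ` B))"
proof (rule hasP_perfect_image_iff[OF tych_subtopology[OF q(1)]])
  show "perfect_map (subtopology K B) (subtopology Q (q ` B)) q"
    using perfect_imp_proper_map[OF q(2)] perfect_imp_continuous_map[OF q(2)] B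
    by (rule perfect_map_restriction) (use B in blast)
qed

text \<open>Collapsing the closed set \<open>D - eX\<close> to a point is a perfect map, and the collapsed space
  satisfies the hypothesis of condition (W) at that point.\<close>

lemma hasP_collapsed:
  assumes D: "eX \<subseteq> D" "D \<subseteq> topspace K" and S: "S \<subseteq> D"
    and q: "tych Q" "perfect_map K Q q"
    and q_eq: "\<And>x y. x \<in> topspace K \<Longrightarrow> y \<in> topspace K \<Longrightarrow>
      q x = q y \<longleftrightarrow> x = y \<or> (x, y) \<in> (D - eX) \<times> (D - eX)"
  shows "hasP P (subtopology Q (q ` D))" (is "hasP P ?Z")
proof -
  have SC: "S \<subseteq> D - eX" using S eX_subset_lambdaP by blast
  then obtain c where c: "c \<in> D - eX" using S_nonempty by blast
  have top: "topspace ?Z = q ` D" using D(2) perfect_imp_surjective_map[OF q(2)] by auto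
  show ?thesis
  proof (rule hasP_condition_W)
    have "D \<lesssim> (UNIV :: 'u set)"
      using subset_imp_lepoll[OF D(2)] topspace_K_lepoll by (rule lepoll_trans)
    then show "topspace ?Z \<lesssim> (UNIV :: 'u set)"
      unfolding top by (rule lepoll_trans[OF image_lepoll])
    show "tych ?Z" by (rule tych_subtopology[OF q(1)])
    show "q c \<in> topspace ?Z" unfolding top using c by blast
    fix V assume "openin ?Z V" and cV: "q c \<in> V"
    then obtain W where W: "openin Q W" "V = W \<inter> q ` D"
      unfolding openin_subtopology by blast
    let ?U = "{k \<in> topspace K. q k \<in> W}"
    have U: "openin K ?U"
      using perfect_imp_continuous_map[OF q(2)] W(1) by (rule openin_continuous_map_preimage)
    have DU: "D - eX \<subseteq> ?U"
    proof
      fix k assume k: "k \<in> D - eX"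
      then have "q k = q c" using q_eq[of k c] c D(2) by blast
      then show "k \<in> ?U" using k D(2) cV W(2) by auto
    qed
    then have "hasP P (subtopology X {x \<in> topspace X. e x \<notin> ?U})"
      using U SC by (intro hasP_outside_neighbourhood) auto
    moreover have "e ` {x \<in> topspace X. e x \<notin> ?U} = eX - ?U" by auto
    ultimately have "hasP P (subtopology K (eX - ?U))"
      using hasP_image_iff[of "{x \<in> topspace X. e x \<notin> ?U}"] by simp
    moreover have "{k \<in> topspace K. q k \<in> q ` (eX - ?U)} = eX - ?U"
      using q_eq eX_subset by blast
    ultimately have "hasP P (subtopology Q (q ` (eX - ?U)))"
      using hasP_saturated_iff[OF q] by blast
    moreover have "q ` (eX - ?U) = topspace ?Z - V"
      unfolding top W(2) using D eX_subset DU by auto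
    moreover have "subtopology ?Z (topspace ?Z - V) = subtopology Q (topspace ?Z - V)"
      unfolding top subtopology_subtopology by (simp add: Int_absorb1)
    ultimately show "hasP P (subtopology ?Z (topspace ?Z - V))" by simp
  qed
qed

lemma S_subset_imp_hasP:
  assumes D: "eX \<subseteq> D" "D \<subseteq> topspace K" "closedin K (D - eX)" and S: "S \<subseteq> D"
  shows "hasP P (subtopology K D)"
proof -
  let ?C = "(D - eX) \<times> (D - eX)"
  have "closedin (prod_topology K K) ?C" "sym ?C" "trans ?C"
    using D(3) by (auto simp: closedin_prod_Times_iff sym_def trans_def)
  then obtain Q :: "'u topology" and q
    where Q: "compact_space Q" "Hausdorff_space Q" and q: "perfect_map K Q q"
      and q_eq: "\<And>x y. x \<in> topspace K \<Longrightarrow> y \<in> topspace K \<Longrightarrow> q x = q y \<longleftrightarrow> x = y \<or> (x, y) \<in> ?C"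
    using closed_per_quotient[OF compact_K Hausdorff_K topspace_K_lepoll] by blast
  have "tych Q" using Q by (rule tych_compact_Hausdorff)
  moreover have "{k \<in> topspace K. q k \<in> q ` D} = D" using q_eq D(2) by blast
  ultimately show ?thesis
    using hasP_saturated_iff[OF _ q] hasP_collapsed[OF D(1,2) S _ q q_eq] by blast
qed

lemma hasP_subtopology_iff_S_subset:
  "eX \<subseteq> D \<Longrightarrow> D \<subseteq> topspace K \<Longrightarrow> closedin K (D - eX) \<Longrightarrow> hasP P (subtopology K D) \<longleftrightarrow> S \<subseteq> D"
  using hasP_imp_S_subset S_subset_imp_hasP by blast

lemma closed_per_poset_remainder: "closed_per_poset K (topspace K - eX) S"
  using Hausdorff_K closedin_S eX_subset_lambdaP S_nonempty by unfold_locales auto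

end

section \<open>Extensions of a space\<close>

lemma is_extD:
  assumes "is_ext X T t"
  shows is_ext_tych: "tych T"
    and is_ext_embedding: "embedding_map X T t"
    and is_ext_dense: "T closure_of (t ` topspace X) = topspace T"
    and is_ext_continuous: "continuous_map X T t"
    and is_ext_image_subset: "t ` topspace X \<subseteq> topspace T"
proof -
  show "tych T" "embedding_map X T t" "T closure_of (t ` topspace X) = topspace T"
    using assms by (simp_all add: is_ext_def)
  then show "continuous_map X T t"
    by (simp add: embedding_imp_continuous_map)
  then show "t ` topspace X \<subseteq> topspace T" by (rule continuous_map_image_subset_topspace)
qed

lemma is_ext_endomorphism_eq_id:
  assumes T: "is_ext X T t" and f: "continuous_map T T f" "\<And>x. x \<in> topspace X \<Longrightarrow> f (t x) = t x"
    and y: "y \<in> topspace T"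
  shows "f y = y"
proof -
  have "y \<in> T closure_of (t ` topspace X)" using y is_ext_dense[OF T] by simp
  then have "f y = id y"
    by (rule forall_in_closure_of_eq) (use is_ext_tych[OF T] f in \<open>auto simp: tych_def\<close>)
  then show ?thesis by simp
qed

lemma ext_eq_iff_ext_le:
  assumes T: "is_ext X T t" and T': "is_ext X T' t'"
  shows "ext_eq X (T, t) (T', t') \<longleftrightarrow> ext_le X (T, t) (T', t') \<and> ext_le X (T', t') (T, t)"
proof
  assume "ext_eq X (T, t) (T', t')"
  then obtain h k where hk: "homeomorphic_maps T T' h k" and h: "\<And>x. x \<in> topspace X \<Longrightarrow> h (t x) = t' x"
    unfolding ext_eq_def by (auto simp: homeomorphic_map_maps)
  then have "k (t' x) = t x" if "x \<in> topspace X" for x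
    using that is_ext_image_subset[OF T] unfolding homeomorphic_maps_def
    by (metis image_subset_iff)
  then show "ext_le X (T, t) (T', t') \<and> ext_le X (T', t') (T, t)"
    using h hk unfolding ext_le_def homeomorphic_maps_def by auto
next
  assume "ext_le X (T, t) (T', t') \<and> ext_le X (T', t') (T, t)"
  then obtain f f' where f: "continuous_map T' T f" "\<And>x. x \<in> topspace X \<Longrightarrow> f (t' x) = t x"
    and f': "continuous_map T T' f'" "\<And>x. x \<in> topspace X \<Longrightarrow> f' (t x) = t' x"
    unfolding ext_le_def by auto
  have "(f \<circ> f') y = y" if "y \<in> topspace T" for y
    using is_ext_endomorphism_eq_id[OF T continuous_map_compose[OF f'(1) f(1)] _ that] f(2) f'(2) by simp
  moreover have "(f' \<circ> f) y = y" if "y \<in> topspace T'" for y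
    using is_ext_endomorphism_eq_id[OF T' continuous_map_compose[OF f(1) f'(1)] _ that] f(2) f'(2) by simp
  ultimately have "homeomorphic_maps T T' f' f"
    using f(1) f'(1) unfolding homeomorphic_maps_def by simp
  then show "ext_eq X (T, t) (T', t')"
    using f'(2) unfolding ext_eq_def by (auto simp: homeomorphic_map_maps)
qed

lemma preimage_of_dense_embedding:
  assumes K: "Hausdorff_space K"
    and e: "continuous_map X K e" "K closure_of (e ` topspace X) = topspace K"
    and t: "embedding_map X T t"
    and f: "continuous_map K T f" "\<And>x. x \<in> topspace X \<Longrightarrow> f (e x) = t x"
    and k: "k \<in> topspace K" "f k \<in> t ` topspace X"
  shows "k \<in> e ` topspace X"
proof -
  let ?tX = "t ` topspace X"
  obtain s where s: "homeomorphic_maps X (subtopology T ?tX) t s"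
    using t unfolding embedding_map_def homeomorphic_map_maps by blast
  have st: "s (t x) = x" if "x \<in> topspace X" for x
    using s that unfolding homeomorphic_maps_def by blast
  define A where "A = {l \<in> topspace K. f l \<in> ?tX}"
  let ?A = "subtopology K A"
  have eO: "e ` topspace X \<subseteq> A"
    using f(2) continuous_map_image_subset_topspace[OF e(1)] by (auto simp: A_def)
  have cont_f: "continuous_map ?A (subtopology T ?tX) f"
    using f(1) by (auto simp: continuous_map_in_subtopology continuous_map_from_subtopology A_def)
  have cont_s: "continuous_map (subtopology T ?tX) X s"
    using s by (simp add: homeomorphic_maps_def)
  have "k \<in> ?A closure_of (e ` topspace X)"
    using k e(2) eO by (simp add: closure_of_subtopology Int_absorb1 A_def)
  moreover have "continuous_map ?A K (e \<circ> (s \<circ> f))"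
    using cont_f cont_s e(1) by (intro continuous_map_compose)
  moreover have "continuous_map ?A K id" by (simp add: continuous_map_from_subtopology)
  moreover have "(e \<circ> (s \<circ> f)) l = id l" if "l \<in> e ` topspace X" for l
    using that f(2) st by auto
  ultimately have "(e \<circ> (s \<circ> f)) k = id k" by (rule forall_in_closure_of_eq[OF _ K])
  then have "e (s (f k)) = k" by simp
  moreover have "s (f k) \<in> topspace X" using k(2) st by auto
  ultimately show ?thesis by (metis imageI)
qed

section \<open>Perfect extensions over subspaces of a compactification\<close>

context compactification
begin

definition perfect_extension :: "'e topology \<Rightarrow> ('a \<Rightarrow> 'e) \<Rightarrow> 'k set \<Rightarrow> ('k \<Rightarrow> 'e) \<Rightarrow> bool" where
  "perfect_extension T t D \<psi> \<longleftrightarrow> eX \<subseteq> D \<and> D \<subseteq> topspace K \<and> perfect_map (subtopology K D) T \<psi> \<and>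
     (\<forall>x\<in>topspace X. \<psi> (e x) = t x)"

lemma perfect_extensionD:
  assumes "perfect_extension T t D \<psi>"
  shows perfect_extension_contains: "eX \<subseteq> D"
    and perfect_extension_subset: "D \<subseteq> topspace K"
    and perfect_extension_perfect: "perfect_map (subtopology K D) T \<psi>"
    and perfect_extension_eq: "x \<in> topspace X \<Longrightarrow> \<psi> (e x) = t x"
    and perfect_extension_topspace: "topspace (subtopology K D) = D"
    and perfect_extension_continuous: "continuous_map (subtopology K D) T \<psi>"
    and perfect_extension_image: "\<psi> ` D = topspace T"
proof -
  show basic: "eX \<subseteq> D" "D \<subseteq> topspace K" "perfect_map (subtopology K D) T \<psi>"
      "x \<in> topspace X \<Longrightarrow> \<psi> (e x) = t x"
    using assms by (simp_all add: perfect_extension_def)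
  show top: "topspace (subtopology K D) = D" using basic(2) by auto
  show "continuous_map (subtopology K D) T \<psi>" "\<psi> ` D = topspace T"
    using perfect_imp_continuous_map[OF basic(3)] perfect_imp_surjective_map[OF basic(3)] top
    by simp_all
qed

text \<open>The graph of a perfect map out of \<open>D\<close> is closed in \<open>K \<times> T\<close>, so over \<open>D'\<close> it contains the
  graph of \<open>f\<close>.\<close>

lemma perfect_extension_maximal:
  assumes \<psi>: "perfect_extension T t D \<psi>"
    and D': "eX \<subseteq> D'" "D' \<subseteq> topspace K"
    and f: "continuous_map (subtopology K D') T f" "\<And>x. x \<in> topspace X \<Longrightarrow> f (e x) = t x"
    and k: "k \<in> D'"
  shows "k \<in> D \<and> \<psi> k = f k"
proof -
  let ?G = "(\<lambda>l. (l, \<psi> l)) ` D"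
  have "proper_map (subtopology K D) (prod_topology K T) (\<lambda>l. (l, \<psi> l))"
    using perfect_imp_proper_map[OF perfect_extension_perfect[OF \<psi>]] Hausdorff_K
      continuous_map_id_subt[unfolded id_def]
    by (intro proper_map_paired) blast
  then have "closedin (prod_topology K T) ?G"
    using perfect_extension_topspace[OF \<psi>] unfolding proper_map_def closed_map_def
    by (metis closedin_topspace)
  moreover have "continuous_map (subtopology K D') (prod_topology K T) (\<lambda>l. (l, f l))"
    using f(1) by (simp add: continuous_map_pairwise o_def continuous_map_from_subtopology)
  ultimately have closed: "closedin (subtopology K D') {l \<in> topspace (subtopology K D'). (l, f l) \<in> ?G}"
    by (rule closedin_continuous_map_preimage[rotated])
  have on_eX: "(l, f l) \<in> ?G" if "l \<in> eX" for l
  proof -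
    have "l \<in> D" "\<psi> l = f l"
      using that f(2) perfect_extension_eq[OF \<psi>] perfect_extension_contains[OF \<psi>] by auto
    then show ?thesis by (simp add: image_iff)
  qed
  have "k \<in> subtopology K D' closure_of eX"
    using dense_in_subspace[OF D'] k by simp
  then have "(k, f k) \<in> ?G" using on_eX closed by (rule forall_in_closure_of)
  then show ?thesis by auto
qed

lemma perfect_extension_unique:
  assumes \<psi>: "perfect_extension T t D \<psi>" and \<psi>': "perfect_extension T t D' \<psi>'"
  shows "D = D'" "\<And>k. k \<in> D \<Longrightarrow> \<psi> k = \<psi>' k"
proof -
  have "k \<in> D' \<and> \<psi>' k = \<psi> k" if "k \<in> D" for k
    using perfect_extension_maximal[OF \<psi>' perfect_extension_contains[OF \<psi>] perfect_extension_subset[OF \<psi>]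
        perfect_extension_continuous[OF \<psi>] perfect_extension_eq[OF \<psi>] that] .
  moreover have "k \<in> D" if "k \<in> D'" for k
    using perfect_extension_maximal[OF \<psi> perfect_extension_contains[OF \<psi>'] perfect_extension_subset[OF \<psi>']
        perfect_extension_continuous[OF \<psi>'] perfect_extension_eq[OF \<psi>'] that] by blast
  ultimately show "D = D'" "\<And>k. k \<in> D \<Longrightarrow> \<psi> k = \<psi>' k" by fastforce+
qed

lemma perfect_extension_dense:
  assumes \<psi>: "perfect_extension T t D \<psi>"
  shows "T closure_of (t ` topspace X) = topspace T"
proof (rule antisym[OF closure_of_subset_topspace])
  have "topspace T = \<psi> ` (subtopology K D closure_of eX)"
    using perfect_extension_image[OF \<psi>]
      dense_in_subspace[OF perfect_extension_contains[OF \<psi>] perfect_extension_subset[OF \<psi>]] by simp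
  also have "\<dots> \<subseteq> T closure_of (\<psi> ` eX)"
    using perfect_extension_continuous[OF \<psi>] by (rule continuous_map_image_closure_subset)
  also have "\<psi> ` eX = t ` topspace X"
    using perfect_extension_eq[OF \<psi>] by (auto simp: image_iff)
  finally show "topspace T \<subseteq> T closure_of (t ` topspace X)" .
qed

lemma perfect_extension_mem_image_iff:
  assumes t: "embedding_map X T t" and \<psi>: "perfect_extension T t D \<psi>" and k: "k \<in> D"
  shows "\<psi> k \<in> t ` topspace X \<longleftrightarrow> k \<in> eX"
proof
  assume "\<psi> k \<in> t ` topspace X"
  moreover have "continuous_map X (subtopology K D) e"
    using continuous_e perfect_extension_contains[OF \<psi>] by (auto simp: continuous_map_in_subtopology)
  moreover have "subtopology K D closure_of eX = topspace (subtopology K D)"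
    using dense_in_subspace[OF perfect_extension_contains[OF \<psi>] perfect_extension_subset[OF \<psi>]]
      perfect_extension_topspace[OF \<psi>] by simp
  ultimately show "k \<in> eX"
    using preimage_of_dense_embedding[OF Hausdorff_space_subtopology[OF Hausdorff_K] _ _ t
        perfect_extension_continuous[OF \<psi>] perfect_extension_eq[OF \<psi>]] k perfect_extension_topspace[OF \<psi>]
    by metis
qed (use perfect_extension_eq[OF \<psi>] in auto)

lemma perfect_extension_compactin_remainder_iff:
  assumes t: "embedding_map X T t" and \<psi>: "perfect_extension T t D \<psi>"
  shows "compactin T (topspace T - t ` topspace X) \<longleftrightarrow> closedin K (D - eX)"
proof -
  have mem_iff: "\<psi> k \<in> t ` topspace X \<longleftrightarrow> k \<in> eX" if "k \<in> D" for k
    using perfect_extension_mem_image_iff[OF t \<psi> that] .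
  have image: "\<psi> ` D = topspace T" by (rule perfect_extension_image[OF \<psi>])
  have preimage: "{k \<in> topspace (subtopology K D). \<psi> k \<in> topspace T - t ` topspace X} = D - eX"
    using mem_iff image unfolding perfect_extension_topspace[OF \<psi>] by auto
  have "compactin T (topspace T - t ` topspace X) \<longleftrightarrow> compactin (subtopology K D) (D - eX)"
  proof
    assume "compactin T (topspace T - t ` topspace X)"
    then show "compactin (subtopology K D) (D - eX)"
      using compactin_proper_map_preimage[OF perfect_imp_proper_map[OF perfect_extension_perfect[OF \<psi>]]]
      unfolding preimage[symmetric] by blast
  next
    assume "compactin (subtopology K D) (D - eX)"
    then have "compactin T (\<psi> ` (D - eX))"
      using perfect_extension_continuous[OF \<psi>] by (rule image_compactin)
    also have "\<psi> ` (D - eX) = topspace T - t ` topspace X"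
    proof -
      have "D - eX = {k \<in> D. \<psi> k \<notin> t ` topspace X}" using mem_iff by blast
      then show ?thesis unfolding image[symmetric] by (simp only:) auto
    qed
    finally show "compactin T (topspace T - t ` topspace X)" .
  qed
  also have "\<dots> \<longleftrightarrow> closedin K (D - eX)"
    using closedin_compact_space[OF compact_K] compactin_imp_closedin[OF Hausdorff_K]
    by (auto simp: compactin_subtopology)
  finally show ?thesis .
qed

lemma perfect_extension_of_perfect_map:
  assumes Q: "tych Q" and q: "perfect_map K Q q" and D: "eX \<subseteq> D" "D \<subseteq> topspace K"
    and saturated: "{k \<in> topspace K. q k \<in> q ` D} = D" "{k \<in> topspace K. q k \<in> q ` eX} = eX"
    and inj: "inj_on q eX"
  shows "perfect_extension (subtopology Q (q ` D)) (q \<circ> e) D q"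
    and "is_ext X (subtopology Q (q ` D)) (q \<circ> e)"
proof -
  let ?T = "subtopology Q (q ` D)"
  have restrict: "perfect_map (subtopology K B) (subtopology Q (q ` B)) q"
    if "{k \<in> topspace K. q k \<in> q ` B} = B" for B
    using perfect_imp_proper_map[OF q] perfect_imp_continuous_map[OF q] that
    by (rule perfect_map_restriction) (use that in blast)
  show ext: "perfect_extension ?T (q \<circ> e) D q"
    using D restrict[OF saturated(1)] unfolding perfect_extension_def by simp
  have "homeomorphic_map (subtopology K eX) (subtopology Q (q ` eX)) q"
    unfolding homeomorphic_eq_injective_perfect_map
    using restrict[OF saturated(2)] inj by (simp add: inj_on_subset)
  then have "homeomorphic_map X (subtopology Q (q ` eX)) (q \<circ> e)"
    using homeomorphic_e homeomorphic_map_compose by blast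
  moreover have "subtopology ?T (q ` eX) = subtopology Q (q ` eX)"
    unfolding subtopology_subtopology using D(1) by (simp add: image_mono Int_absorb1)
  moreover have "q ` eX = (q \<circ> e) ` topspace X" by (simp add: image_comp)
  ultimately have "embedding_map X ?T (q \<circ> e)" unfolding embedding_map_def by simp
  then show "is_ext X ?T (q \<circ> e)"
    unfolding is_ext_def using perfect_extension_dense[OF ext] tych_subtopology[OF Q] by blast
qed

lemma ex_perfect_extension_of_map:
  assumes t: "continuous_map X T t" "T closure_of (t ` topspace X) = topspace T"
    and Q: "Hausdorff_space Q" and c: "embedding_map T Q c"
    and q: "continuous_map K Q q" "\<And>x. x \<in> topspace X \<Longrightarrow> q (e x) = c (t x)"
  shows "\<exists>D \<psi>. perfect_extension T t D \<psi>"
proof -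
  let ?cT = "c ` topspace T"
  obtain c' where c': "homeomorphic_maps T (subtopology Q ?cT) c c'"
    using c by (auto simp: embedding_map_def homeomorphic_map_maps)
  then have c'c: "c' (c y) = y" if "y \<in> topspace T" for y
    using that by (simp add: homeomorphic_maps_def)
  have cont: "continuous_map T Q c" using c by (rule embedding_imp_continuous_map)
  have tX: "t x \<in> topspace T" if "x \<in> topspace X" for x
    using that continuous_map_image_subset_topspace[OF t(1)] by blast
  have proper: "proper_map K Q q"
    by (rule continuous_imp_proper_map[OF compact_K Hausdorff_imp_kc_space[OF Q] q(1)])
  have "closedin Q (q ` topspace K)"
    using proper unfolding proper_map_def closed_map_def by blast
  moreover have "c ` t ` topspace X = q ` eX"
    using q(2) by (simp add: image_comp)
  then have "c ` t ` topspace X \<subseteq> q ` topspace K" using eX_subset by blast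
  ultimately have "Q closure_of (c ` t ` topspace X) \<subseteq> q ` topspace K"
    by (rule closure_of_minimal[rotated])
  then have onto: "?cT \<subseteq> q ` topspace K"
    using continuous_map_image_closure_subset[OF cont, of "t ` topspace X"] t(2) by simp
  define D where "D = {k \<in> topspace K. q k \<in> ?cT}"
  have "perfect_map (subtopology K D) (subtopology Q ?cT) q"
    by (rule perfect_map_restriction[OF proper q(1) D_def[symmetric] onto])
  moreover have "perfect_map (subtopology Q ?cT) T c'"
    using c' homeomorphic_imp_perfect_map homeomorphic_maps_sym unfolding homeomorphic_map_maps by blast
  ultimately have "perfect_map (subtopology K D) T (c' \<circ> q)" by (rule perfect_map_compose)
  moreover have "eX \<subseteq> D" using eX_subset q(2) tX by (auto simp: D_def)
  ultimately have "perfect_extension T t D (c' \<circ> q)"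
    unfolding perfect_extension_def using q(2) c'c tX by (auto simp: D_def)
  then show ?thesis by blast
qed

definition fibre_rel :: "'k set \<Rightarrow> ('k \<Rightarrow> 'e) \<Rightarrow> ('k \<times> 'k) set" where
  "fibre_rel D \<psi> = {(k, l). k \<in> D - eX \<and> l \<in> D - eX \<and> \<psi> k = \<psi> l}"

lemma mem_fibre_rel_iff: "(k, l) \<in> fibre_rel D \<psi> \<longleftrightarrow> k \<in> D - eX \<and> l \<in> D - eX \<and> \<psi> k = \<psi> l"
  by (simp add: fibre_rel_def)

lemma closedin_fibre_rel:
  assumes \<psi>: "perfect_extension T t D \<psi>" and T: "Hausdorff_space T" and D: "closedin K (D - eX)"
  shows "closedin (prod_topology K K) (fibre_rel D \<psi>)"
proof -
  let ?C = "subtopology K (D - eX)"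
  have top: "topspace ?C = D - eX" using closedin_subset[OF D] by auto
  have "continuous_map (subtopology (subtopology K D) (D - eX)) T \<psi>"
    by (rule continuous_map_from_subtopology[OF perfect_extension_continuous[OF \<psi>]])
  then have "continuous_map ?C T \<psi>" by (simp add: subtopology_subtopology Int_absorb1 Diff_subset)
  then have "continuous_map (prod_topology ?C ?C) T (\<psi> \<circ> fst)"
    "continuous_map (prod_topology ?C ?C) T (\<psi> \<circ> snd)"
    using continuous_map_compose[OF continuous_map_fst] continuous_map_compose[OF continuous_map_snd]
    by blast+
  then have "closedin (prod_topology ?C ?C)
      {z \<in> topspace (prod_topology ?C ?C). (\<psi> \<circ> fst) z = (\<psi> \<circ> snd) z}"
    by (rule closedin_continuous_maps_eq[OF T])
  moreover have "{z \<in> topspace (prod_topology ?C ?C). (\<psi> \<circ> fst) z = (\<psi> \<circ> snd) z} = fibre_rel D \<psi>"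
    unfolding topspace_prod_topology top by (auto simp: fibre_rel_def)
  moreover have "closedin (prod_topology K K) ((D - eX) \<times> (D - eX))"
    using D by (simp add: closedin_prod_Times_iff)
  ultimately show ?thesis
    unfolding subtopology_Times[symmetric] by (simp add: closedin_closed_subtopology)
qed

lemma perfect_extension_eq_mono:
  assumes t': "embedding_map X T' t'"
    and \<psi>: "perfect_extension T t D \<psi>" and \<psi>': "perfect_extension T' t' D' \<psi>'"
    and sub: "fibre_rel D' \<psi>' \<subseteq> fibre_rel D \<psi>"
    and kl: "k \<in> D'" "l \<in> D'" "\<psi>' k = \<psi>' l"
  shows "\<psi> k = \<psi> l"
proof (cases "k \<in> eX")
  case True
  then have "l \<in> eX" using perfect_extension_mem_image_iff[OF t' \<psi>'] kl by metis
  then obtain x y where xy: "x \<in> topspace X" "y \<in> topspace X" "k = e x" "l = e y" using True by blast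
  then have "t' x = t' y" using kl(3) perfect_extension_eq[OF \<psi>'] by simp
  then show ?thesis using xy inj_onD[OF embedding_imp_inj_on[OF t']] by blast
next
  case False
  then have "l \<notin> eX" using perfect_extension_mem_image_iff[OF t' \<psi>'] kl by metis
  then have "(k, l) \<in> fibre_rel D' \<psi>'" using False kl by (simp add: mem_fibre_rel_iff)
  then have "(k, l) \<in> fibre_rel D \<psi>" by (rule subsetD[OF sub])
  then show ?thesis by (simp add: mem_fibre_rel_iff)
qed

lemma ext_le_iff_fibre_rel_subset:
  assumes t': "embedding_map X T' t'"
    and \<psi>: "perfect_extension T t D \<psi>" and \<psi>': "perfect_extension T' t' D' \<psi>'"
  shows "ext_le X (T, t) (T', t') \<longleftrightarrow> fibre_rel D' \<psi>' \<subseteq> fibre_rel D \<psi>"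
proof
  assume "ext_le X (T, t) (T', t')"
  then obtain f where f: "continuous_map T' T f" "\<And>x. x \<in> topspace X \<Longrightarrow> f (t' x) = t x"
    unfolding ext_le_def by auto
  have "k \<in> D \<and> \<psi> k = (f \<circ> \<psi>') k" if "k \<in> D'" for k
  proof (rule perfect_extension_maximal[OF \<psi> _ _ _ _ that])
    show "continuous_map (subtopology K D') T (f \<circ> \<psi>')"
      using perfect_extension_continuous[OF \<psi>'] f(1) by (rule continuous_map_compose)
  qed (use perfect_extensionD[OF \<psi>'] f(2) in auto)
  then show "fibre_rel D' \<psi>' \<subseteq> fibre_rel D \<psi>" by (auto simp: fibre_rel_def)
next
  assume sub: "fibre_rel D' \<psi>' \<subseteq> fibre_rel D \<psi>"
  have "k \<in> D" if "k \<in> D'" for k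
  proof (cases "k \<in> eX")
    case False
    then have "(k, k) \<in> fibre_rel D' \<psi>'" using that by (simp add: mem_fibre_rel_iff)
    then have "(k, k) \<in> fibre_rel D \<psi>" by (rule subsetD[OF sub])
    then show ?thesis by (simp add: mem_fibre_rel_iff)
  qed (use perfect_extension_contains[OF \<psi>] in blast)
  then have "subtopology K D' = subtopology (subtopology K D) D'"
    by (simp add: subtopology_subtopology Int_absorb1 subsetI)
  then have cont: "continuous_map (subtopology K D') T \<psi>"
    using continuous_map_from_subtopology[OF perfect_extension_continuous[OF \<psi>]] by simp
  have quot: "quotient_map (subtopology K D') T' \<psi>'"
    by (rule perfect_imp_quotient_map[OF perfect_extension_perfect[OF \<psi>']])
  obtain f where f: "continuous_map T' T f" "\<And>k. k \<in> D' \<Longrightarrow> f (\<psi>' k) = \<psi> k"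
    using quotient_map_lift_exists[OF quot cont] perfect_extension_eq_mono[OF t' \<psi> \<psi>' sub]
    unfolding perfect_extension_topspace[OF \<psi>'] by metis
  have "f (t' x) = t x" if "x \<in> topspace X" for x
    using f(2)[of "e x"] that perfect_extension_contains[OF \<psi>']
      perfect_extension_eq[OF \<psi>' that] perfect_extension_eq[OF \<psi> that] by auto
  then show "ext_le X (T, t) (T', t')" unfolding ext_le_def using f(1) by auto
qed

lemma ex_extension_of_closed_per:
  assumes card: "topspace K \<lesssim> (UNIV :: 'e set)"
    and r: "closedin (prod_topology K K) r" "r \<subseteq> (topspace K - eX) \<times> (topspace K - eX)" "sym r" "trans r"
  obtains T :: "'e topology" and t D \<psi> where "is_ext X T t" "compactin T (topspace T - t ` topspace X)"
    "perfect_extension T t D \<psi>" "fibre_rel D \<psi> = r"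
proof -
  obtain Q :: "'e topology" and q
    where Q: "compact_space Q" "Hausdorff_space Q" and q: "perfect_map K Q q"
      and q_eq: "\<And>k l. k \<in> topspace K \<Longrightarrow> l \<in> topspace K \<Longrightarrow> q k = q l \<longleftrightarrow> k = l \<or> (k, l) \<in> r"
    using closed_per_quotient[OF compact_K Hausdorff_K card r(1,3,4)] by blast
  define C where "C = {k \<in> topspace K. (k, k) \<in> r}"
  have C_iff: "k \<in> C \<longleftrightarrow> (k, k) \<in> r" for k
    using r(2) by (auto simp: C_def)
  have rC: "k \<in> C \<and> l \<in> C" if "(k, l) \<in> r" for k l
    using symD[OF r(3) that] transD[OF r(4)] that unfolding C_iff by blast
  have C: "C \<subseteq> topspace K" "C \<inter> eX = {}" "(eX \<union> C) - eX = C"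
    using r(2) unfolding C_def by blast+
  let ?T = "subtopology Q (q ` (eX \<union> C))"
  have D: "eX \<subseteq> eX \<union> C" "eX \<union> C \<subseteq> topspace K" using eX_subset C(1) by blast+
  have q_eX: "k = l" if "k \<in> topspace K" "l \<in> eX" "q k = q l" for k l
    using q_eq[of k l] that rC C(2) eX_subset by blast
  have q_C: "k \<in> C" if "k \<in> topspace K" "l \<in> C" "q k = q l" for k l
    using q_eq[of k l] that rC[of k l] C(1) by blast
  have saturated: "{k \<in> topspace K. q k \<in> q ` (eX \<union> C)} = eX \<union> C" "{k \<in> topspace K. q k \<in> q ` eX} = eX"
    using D q_eX q_C by blast+
  have inj: "inj_on q eX" using q_eX eX_subset unfolding inj_on_def by blast
  note ext = perfect_extension_of_perfect_map[OF tych_compact_Hausdorff[OF Q] q D saturated inj]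
  have "closedin K (eX \<union> C - eX)"
    unfolding C(3) unfolding C_def
    by (rule closedin_continuous_map_preimage[OF _ r(1)]) (simp add: continuous_map_pairwise o_def)
  then have "compactin ?T (topspace ?T - (q \<circ> e) ` topspace X)"
    using perfect_extension_compactin_remainder_iff[OF is_ext_embedding[OF ext(2)] ext(1)] by blast
  moreover have "(k, l) \<in> fibre_rel (eX \<union> C) q \<longleftrightarrow> (k, l) \<in> r" for k l
    using q_eq[of k l] C(1) rC[of k l] C_iff unfolding mem_fibre_rel_iff C(3) by blast
  then have "fibre_rel (eX \<union> C) q = r" by auto
  ultimately show thesis using ext by (intro that)
qed

end

lemma (in locally_P_compactification) hasP_iff_S_subset_of_perfect_extension:
  assumes \<psi>: "perfect_extension T t D \<psi>" and T: "tych T" and D: "closedin K (D - eX)"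
  shows "hasP P T \<longleftrightarrow> S \<subseteq> D"
proof -
  have "hasP P (subtopology K D) \<longleftrightarrow> hasP P T"
    using T perfect_extension_perfect[OF \<psi>] by (rule hasP_perfect_image_iff)
  then show ?thesis
    using hasP_subtopology_iff_S_subset[OF perfect_extension_contains[OF \<psi>]
        perfect_extension_subset[OF \<psi>] D]
    by simp
qed

section \<open>Extensions as closed partial equivalence relations\<close>

locale stone_cech_compactification =
  fixes X :: "'a topology" and K :: "'k topology" and e :: "'a \<Rightarrow> 'k"
  assumes stone_cech: "stone_cech X K e"

sublocale stone_cech_compactification \<subseteq> compactification
  using stone_cech by unfold_locales (simp_all add: stone_cech_def)

context stone_cech_compactification
begin

lemma ex_cube_extension:
  assumes f: "continuous_map X (product_topology (\<lambda>i. top_of_set {0..1::real}) I) f"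
  obtains q where "continuous_map K (product_topology (\<lambda>i. top_of_set {0..1::real}) I) q"
    "\<And>x. x \<in> topspace X \<Longrightarrow> q (e x) = f x"
proof -
  have "\<exists>g. continuous_map K (top_of_set {0..1::real}) g \<and> (\<forall>x\<in>topspace X. g (e x) = f x i)"
    if "i \<in> I" for i
    using stone_cech f that unfolding stone_cech_def continuous_map_componentwise by blast
  then obtain g where g: "\<And>i. i \<in> I \<Longrightarrow> continuous_map K (top_of_set {0..1::real}) (g i)"
      "\<And>i x. i \<in> I \<Longrightarrow> x \<in> topspace X \<Longrightarrow> g i (e x) = f x i"
    by metis
  define q where "q k = restrict (\<lambda>i. g i k) I" for k
  have "continuous_map K (product_topology (\<lambda>i. top_of_set {0..1}) I) q"
    unfolding continuous_map_componentwise
  proof (intro conjI ballI)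
    fix i assume "i \<in> I"
    then show "continuous_map K (top_of_set {0..1}) (\<lambda>k. q k i)" using g(1) by (simp add: q_def)
  qed (auto simp: q_def)
  moreover have "q (e x) = f x" if x: "x \<in> topspace X" for x
  proof
    have "f x \<in> extensional I"
      using f x unfolding continuous_map_componentwise by blast
    then show "q (e x) i = f x i" for i
      using g(2)[OF _ x] by (auto simp: q_def extensional_def)
  qed
  ultimately show thesis by (rule that)
qed

lemma ex_perfect_extension:
  fixes T :: "'e topology"
  assumes T: "tych T" and t: "continuous_map X T t" "T closure_of (t ` topspace X) = topspace T"
  shows "\<exists>D \<psi>. perfect_extension T t D \<psi>"
proof -
  obtain I :: "('e \<Rightarrow> real) set" and c
    where c: "embedding_map T (product_topology (\<lambda>i. top_of_set {0..1::real}) I) c"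
    using completely_regular_space_cube_embedding T unfolding tych_def by blast
  then have "continuous_map X (product_topology (\<lambda>i. top_of_set {0..1::real}) I) (c \<circ> t)"
    using continuous_map_compose[OF t(1) embedding_imp_continuous_map] by blast
  then obtain q where q: "continuous_map K (product_topology (\<lambda>i. top_of_set {0..1::real}) I) q"
      "\<And>x. x \<in> topspace X \<Longrightarrow> q (e x) = (c \<circ> t) x"
    using ex_cube_extension by blast
  moreover have "Hausdorff_space (product_topology (\<lambda>i :: 'e \<Rightarrow> real. top_of_set {0..1::real}) I)"
    by (simp add: Hausdorff_space_product_topology Hausdorff_space_subtopology)
  ultimately show ?thesis
    using ex_perfect_extension_of_map[OF t _ c] by simp
qed

definition ext_rel :: "'e topology \<times> ('a \<Rightarrow> 'e) \<Rightarrow> ('k \<times> 'k) set" where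
  "ext_rel E = {(k, l). \<exists>D \<psi>. perfect_extension (fst E) (snd E) D \<psi> \<and> (k, l) \<in> fibre_rel D \<psi>}"

lemma ext_rel_eq_fibre_rel:
  assumes "perfect_extension T t D \<psi>"
  shows "ext_rel (T, t) = fibre_rel D \<psi>"
proof
  show "ext_rel (T, t) \<subseteq> fibre_rel D \<psi>"
    using perfect_extension_unique[OF assms] by (auto simp: ext_rel_def fibre_rel_def)
  show "fibre_rel D \<psi> \<subseteq> ext_rel (T, t)"
    using assms by (auto simp: ext_rel_def)
qed

lemma ext_le_iff_ext_rel_subset:
  assumes E: "is_ext X T t" and E': "is_ext X T' t'"
  shows "ext_le X (T, t) (T', t') \<longleftrightarrow> ext_rel (T', t') \<subseteq> ext_rel (T, t)"
proof -
  obtain D \<psi> D' \<psi>' where "perfect_extension T t D \<psi>" "perfect_extension T' t' D' \<psi>'"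
    using ex_perfect_extension is_ext_tych[OF E] is_ext_continuous[OF E] is_ext_dense[OF E]
      is_ext_tych[OF E'] is_ext_continuous[OF E'] is_ext_dense[OF E'] by metis
  then show ?thesis
    using ext_le_iff_fibre_rel_subset[OF is_ext_embedding[OF E']] by (simp add: ext_rel_eq_fibre_rel)
qed

lemma ext_eq_iff_ext_rel_eq:
  assumes "is_ext X T t" "is_ext X T' t'"
  shows "ext_eq X (T, t) (T', t') \<longleftrightarrow> ext_rel (T, t) = ext_rel (T', t')"
  using assms by (auto simp: ext_eq_iff_ext_le ext_le_iff_ext_rel_subset)

end

locale stone_cech_locally_P = locally_P_compactification P X K e + stone_cech_compactification X K e
  for P :: "'u topology \<Rightarrow> bool" and X :: "'a topology" and K :: "'k topology" and e
begin

abbreviation "PERs \<equiv> closed_pers K (topspace K - eX) S"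

lemma ext_rel_in_closed_pers:
  assumes "E \<in> EP_reps P X"
  shows "ext_rel E \<in> PERs"
proof -
  obtain T t where E: "E = (T, t)" "is_ext X T t" "hasP P T" "compactin T (topspace T - t ` topspace X)"
    using assms unfolding EP_reps_def by blast
  obtain D \<psi> where \<psi>: "perfect_extension T t D \<psi>"
    using ex_perfect_extension is_ext_tych[OF E(2)] is_ext_continuous[OF E(2)] is_ext_dense[OF E(2)]
    by blast
  have D: "closedin K (D - eX)"
    using E(4) by (simp add: perfect_extension_compactin_remainder_iff[OF is_ext_embedding[OF E(2)] \<psi>])
  then have "S \<subseteq> D"
    using hasP_iff_S_subset_of_perfect_extension[OF \<psi> is_ext_tych[OF E(2)]] E(3) by blast
  then have "S \<subseteq> D - eX" using eX_subset_lambdaP by blast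
  then have "Id_on S \<subseteq> fibre_rel D \<psi>" unfolding fibre_rel_def by blast
  moreover have "closedin (prod_topology K K) (fibre_rel D \<psi>)"
    using closedin_fibre_rel[OF \<psi> _ D] is_ext_tych[OF E(2)] by (simp add: tych_def)
  moreover have "fibre_rel D \<psi> \<subseteq> (topspace K - eX) \<times> (topspace K - eX)"
    using perfect_extension_subset[OF \<psi>] by (auto simp: fibre_rel_def)
  moreover have "sym (fibre_rel D \<psi>)" "trans (fibre_rel D \<psi>)"
    by (auto simp: fibre_rel_def sym_def trans_def)
  ultimately show ?thesis
    unfolding E(1) ext_rel_eq_fibre_rel[OF \<psi>] closed_pers_def by simp
qed

lemma ex_extension_with_ext_rel:
  assumes "r \<in> PERs"
  shows "\<exists>E\<in>EP_reps P X :: ('a set set topology \<times> _) set. ext_rel E = r"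
proof -
  have r: "closedin (prod_topology K K) r" "r \<subseteq> (topspace K - eX) \<times> (topspace K - eX)" "sym r" "trans r"
    and Id: "Id_on S \<subseteq> r"
    using assms by (simp_all add: closed_pers_def)
  obtain T :: "'a set set topology" and t D \<psi>
    where T: "is_ext X T t" "compactin T (topspace T - t ` topspace X)"
      and \<psi>: "perfect_extension T t D \<psi>" "fibre_rel D \<psi> = r"
    using ex_extension_of_closed_per[OF topspace_lepoll_UNIV r] .
  have "S \<subseteq> D" using Id unfolding \<psi>(2)[symmetric] by (auto simp: fibre_rel_def)
  moreover have "closedin K (D - eX)"
    using T(2) by (simp add: perfect_extension_compactin_remainder_iff[OF is_ext_embedding[OF T(1)] \<psi>(1)])
  ultimately have "hasP P T"
    using hasP_iff_S_subset_of_perfect_extension[OF \<psi>(1) is_ext_tych[OF T(1)]] by blast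
  then have "(T, t) \<in> EP_reps P X" using T by (simp add: EP_reps_def)
  moreover have "ext_rel (T, t) = r" using ext_rel_eq_fibre_rel[OF \<psi>(1)] \<psi>(2) by simp
  ultimately show ?thesis by blast
qed

definition class_rel :: "('e topology \<times> ('a \<Rightarrow> 'e)) set \<Rightarrow> ('k \<times> 'k) set" where
  "class_rel A = (\<Union>E\<in>A. ext_rel E)"

lemma EP_class:
  assumes "A \<in> EP P X"
  shows "A = {E \<in> EP_reps P X. ext_rel E = class_rel A}" "A \<noteq> {}"
proof -
  obtain E where E: "E \<in> EP_reps P X" "A = {E' \<in> EP_reps P X. ext_eq X E E'}"
    using assms unfolding EP_def by blast
  have "ext_eq X E E' \<longleftrightarrow> ext_rel E' = ext_rel E" if "E' \<in> EP_reps P X" for E'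
    using E(1) that ext_eq_iff_ext_rel_eq unfolding EP_reps_def by fastforce
  then have A: "A = {E' \<in> EP_reps P X. ext_rel E' = ext_rel E}" using E(2) by blast
  then have "E \<in> A" using E(1) by blast
  moreover have "class_rel A = ext_rel E" using A \<open>E \<in> A\<close> unfolding class_rel_def by blast
  ultimately show "A = {E \<in> EP_reps P X. ext_rel E = class_rel A}" "A \<noteq> {}"
    using A \<open>E \<in> A\<close> by (simp, blast)
qed

lemma class_rel_eq: "A \<in> EP P X \<Longrightarrow> E \<in> A \<Longrightarrow> E \<in> EP_reps P X \<and> ext_rel E = class_rel A"
  using EP_class(1) by blast

abbreviation EPX :: "('a set set topology \<times> ('a \<Rightarrow> 'a set set)) set set" where
  "EPX \<equiv> EP P X"

lemma bij_betw_class_rel: "bij_betw class_rel EPX PERs"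
  unfolding bij_betw_def
proof
  show "inj_on class_rel EPX"
  proof (rule inj_onI)
    fix A B assume AB: "A \<in> EPX" "B \<in> EPX" "class_rel A = class_rel B"
    show "A = B" using EP_class(1)[OF AB(1)] EP_class(1)[OF AB(2)] AB(3) by simp
  qed
  show "class_rel ` EPX = PERs"
  proof
    show "class_rel ` EPX \<subseteq> PERs"
    proof clarify
      fix A assume A: "A \<in> EPX"
      then obtain E where "E \<in> A" using EP_class(2) by blast
      then show "class_rel A \<in> PERs" using class_rel_eq[OF A] ext_rel_in_closed_pers by metis
    qed
    show "PERs \<subseteq> class_rel ` EPX"
    proof
      fix r assume "r \<in> PERs"
      then obtain E :: "'a set set topology \<times> ('a \<Rightarrow> 'a set set)"
        where E: "E \<in> EP_reps P X" "ext_rel E = r"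
        using ex_extension_with_ext_rel by blast
      let ?A = "{E' \<in> EP_reps P X. ext_eq X E E'}"
      have A: "?A \<in> EPX" unfolding EP_def using E(1) by blast
      have "ext_eq X E E"
        using E(1) ext_eq_iff_ext_rel_eq unfolding EP_reps_def by fastforce
      then have "class_rel ?A = r" using class_rel_eq[OF A, of E] E by simp
      then show "r \<in> class_rel ` EPX" using A by blast
    qed
  qed
qed

lemma EP_le_iff_class_rel_subset:
  assumes A: "A \<in> EP P X" and B: "B \<in> EP P X"
  shows "EP_le X A B \<longleftrightarrow> class_rel B \<subseteq> class_rel A"
proof -
  have "ext_le X E E' \<longleftrightarrow> class_rel B \<subseteq> class_rel A" if "E \<in> A" "E' \<in> B" for E E'
    using class_rel_eq[OF A that(1)] class_rel_eq[OF B that(2)] ext_le_iff_ext_rel_subset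
    unfolding EP_reps_def by fastforce
  then show ?thesis
    using EP_class(2)[OF A] EP_class(2)[OF B] unfolding EP_le_def by blast
qed

end

theorem homeomorphic_remainders_of_order_isomorphic_EP:
  assumes X: "stone_cech_locally_P P X KX eX" and Y: "stone_cech_locally_P P Y KY eY"
    and iso: "order_isomorphic_EP X (EP P X :: ('a set set topology \<times> ('a \<Rightarrow> 'a set set)) set set)
                             Y (EP P Y :: ('b set set topology \<times> ('b \<Rightarrow> 'b set set)) set set)"
  shows "subtopology KX (topspace KX - lambdaP P X KX eX) homeomorphic_space
         subtopology KY (topspace KY - lambdaP P Y KY eY)"
proof -
  interpret X: stone_cech_locally_P P X KX eX by fact
  interpret Y: stone_cech_locally_P P Y KY eY by fact
  obtain \<phi> where \<phi>: "bij_betw \<phi> X.EPX Y.EPX"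
    and \<phi>_le: "\<And>A B. A \<in> X.EPX \<Longrightarrow> B \<in> X.EPX \<Longrightarrow> EP_le X A B \<longleftrightarrow> EP_le Y (\<phi> A) (\<phi> B)"
    using iso unfolding order_isomorphic_EP_def by blast
  define \<iota> where "\<iota> = inv_into X.EPX X.class_rel"
  define \<Phi> where "\<Phi> = Y.class_rel \<circ> (\<phi> \<circ> \<iota>)"
  have \<iota>: "bij_betw \<iota> X.PERs X.EPX"
    unfolding \<iota>_def by (rule bij_betw_inv_into[OF X.bij_betw_class_rel])
  have "\<Phi> r \<subseteq> \<Phi> s \<longleftrightarrow> r \<subseteq> s" if rs: "r \<in> X.PERs" "s \<in> X.PERs" for r s
  proof -
    have \<iota>_in: "\<iota> r \<in> X.EPX" "\<iota> s \<in> X.EPX" using bij_betwE[OF \<iota>] rs by blast+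
    then have \<phi>_in: "\<phi> (\<iota> r) \<in> Y.EPX" "\<phi> (\<iota> s) \<in> Y.EPX" using bij_betwE[OF \<phi>] by blast+
    have "\<Phi> r \<subseteq> \<Phi> s \<longleftrightarrow> EP_le Y (\<phi> (\<iota> s)) (\<phi> (\<iota> r))"
      using Y.EP_le_iff_class_rel_subset[OF \<phi>_in(2,1)] by (simp add: \<Phi>_def)
    also have "\<dots> \<longleftrightarrow> EP_le X (\<iota> s) (\<iota> r)" using \<phi>_le \<iota>_in by simp
    also have "\<dots> \<longleftrightarrow> X.class_rel (\<iota> r) \<subseteq> X.class_rel (\<iota> s)"
      by (rule X.EP_le_iff_class_rel_subset[OF \<iota>_in(2,1)])
    also have "\<dots> \<longleftrightarrow> r \<subseteq> s"
      using bij_betw_inv_into_right[OF X.bij_betw_class_rel] rs by (simp add: \<iota>_def)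
    finally show ?thesis .
  qed
  moreover have "bij_betw \<Phi> X.PERs Y.PERs"
    unfolding \<Phi>_def by (intro bij_betw_trans[OF bij_betw_trans[OF \<iota> \<phi>] Y.bij_betw_class_rel])
  ultimately have "order_iso \<Phi> X.PERs Y.PERs" by (simp add: order_iso_def)
  then have "closed_per_iso KX (topspace KX - X.eX) X.S KY (topspace KY - Y.eX) Y.S \<Phi>"
    using X.closed_per_poset_remainder Y.closed_per_poset_remainder
    by (simp add: closed_per_iso_def closed_per_iso_axioms_def)
  then show ?thesis by (rule closed_per_iso.homeomorphic_subspaces)
qed

section \<open>The empty space and cardinalities\<close>

lemma times_bool_lepoll_Pow:
  assumes "x \<noteq> y" "x \<noteq> z" "y \<noteq> (z :: 'a)"
  shows "(UNIV :: ('a \<times> bool) set) \<lesssim> (UNIV :: 'a set set)"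
proof -
  have ne: "{a} \<noteq> - {b}" for a b :: 'a
  proof
    assume "{a} = - {b}"
    then have "v = a \<or> v = b" for v by blast
    then show False using assms by metis
  qed
  have "inj (\<lambda>(a :: 'a, b). if b then {a} else - {a})"
    using ne by (auto simp: inj_def split: if_splits)
  then show ?thesis unfolding lepoll_def by blast
qed

lemma set_set_times_bool_lepoll:
  fixes i :: "'a \<Rightarrow> 'c" and g :: "'c set set set \<Rightarrow> 'u"
  assumes i: "inj i" and g: "inj g"
  shows "(UNIV :: ('a set set \<times> bool) set) \<lesssim> (UNIV :: 'u set)"
proof -
  have "inj ((`) ((`) i))" using i by (simp add: inj_image_eq_iff inj_def)
  then have "(UNIV :: 'a set set set) \<lesssim> (UNIV :: 'c set set set)"
    unfolding lepoll_def by blast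
  then have "(UNIV :: 'a set set set) \<times> (UNIV :: bool set)
      \<lesssim> (UNIV :: 'c set set set) \<times> (UNIV :: bool set)"
    by (intro times_lepoll_mono lepoll_refl)
  also have "(UNIV :: 'c set set set) \<times> (UNIV :: bool set) \<lesssim> (UNIV :: 'c set set set set)"
    using times_bool_lepoll_Pow[of "{} :: 'c set set" "{{}}" "{UNIV}"] by simp
  also have "\<dots> \<lesssim> (UNIV :: 'u set)"
    using g unfolding lepoll_def by blast
  finally show ?thesis by simp
qed

text \<open>If the empty space lacks \<open>P\<close>, then so does every Tychonoff space, as the empty set is clopen;
  a locally-\<open>P\<close> space is then empty.\<close>

lemma (in compactness_like_property) locally_P_imp_empty:
  assumes X: "topspace X = {}" "\<not> hasP P X" and Y: "tych Y" "locally_P P Y"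
  shows "topspace Y = {}"
proof (rule ccontr)
  assume "topspace Y \<noteq> {}"
  then obtain U where "hasP P (subtopology Y (Y closure_of U))"
    using Y(2) unfolding locally_P_def by blast
  then have "hasP P (subtopology (subtopology Y (Y closure_of U)) {})"
    by (rule hasP_clopen[OF tych_subtopology[OF Y(1)]]) auto
  moreover have "subtopology (subtopology Y (Y closure_of U)) {} homeomorphic_space X"
    using X(1) by (simp add: homeomorphic_empty_space_eq)
  ultimately show False using X(2) hasP_homeomorphic by blast
qed

theorem theorem4p12:
  fixes P :: "'u topology \<Rightarrow> bool"
    and X :: "'a topology" and Y :: "'b topology"
    and KX :: "'c topology" and eX :: "'a \<Rightarrow> 'c"
    and KY :: "'d topology" and eY :: "'b \<Rightarrow> 'd"
  assumes "compactness_like P"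
    and "\<exists>g :: ('a + 'b) set set set \<Rightarrow> 'u. inj g"
    and "tych X" and "tych Y"
    and "locally_P P X" and "locally_P P Y"
    and "\<not> hasP P X" and "\<not> hasP P Y"
    and "stone_cech X KX eX" and "stone_cech Y KY eY"
    and "order_isomorphic_EP X (EP P X :: ('a set set topology \<times> ('a \<Rightarrow> 'a set set)) set set)
                             Y (EP P Y :: ('b set set topology \<times> ('b \<Rightarrow> 'b set set)) set set)"
  shows "subtopology KX (topspace KX - lambdaP P X KX eX) homeomorphic_space
         subtopology KY (topspace KY - lambdaP P Y KY eY)"
proof -
  interpret compactness_like_property P by unfold_locales fact
  interpret X: stone_cech_compactification X KX eX by unfold_locales fact
  interpret Y: stone_cech_compactification Y KY eY by unfold_locales fact
  have empty_iff: "topspace X = {} \<longleftrightarrow> topspace Y = {}"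
    using locally_P_imp_empty[of X Y] locally_P_imp_empty[of Y X] assms(3-8) by blast
  show ?thesis
  proof (cases "topspace X = {}")
    case True
    then have "topspace KX = {}" "topspace KY = {}"
      using empty_iff X.dense_image Y.dense_image by auto
    then show ?thesis by (simp add: homeomorphic_empty_space_eq)
  next
    case False
    have "(UNIV :: ('a set set \<times> bool) set) \<lesssim> (UNIV :: 'u set)"
      and "(UNIV :: ('b set set \<times> bool) set) \<lesssim> (UNIV :: 'u set)"
      using assms(2) set_set_times_bool_lepoll[OF inj_Inl] set_set_times_bool_lepoll[OF inj_Inr] by blast+
    then have "stone_cech_locally_P P X KX eX" "stone_cech_locally_P P Y KY eY"
      using False empty_iff assms(5-8) by unfold_locales auto
    then show ?thesis using assms(11) by (rule homeomorphic_remainders_of_order_isomorphic_EP)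
  qed
qed

end
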